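(* Consider the $\mathbb{C}P^2$ sigma model equations $$\partial\bar\partial w_1-\frac{2\bar w_1}{A_2}\partial w_1\bar\partial w_1-\frac{\bar w_2}{A_2}(\partial w_1\bar\partial w_2+\bar\partial w_1\partial w_2)=0,$$ $$\partial\bar\partial w_2-\frac{2\bar w_2}{A_2}\partial w_2\bar\partial w_2-\frac{\bar w_1}{A_2}(\partial w_1\bar\partial w_2+\bar\partial w_1\partial w_2)=0,\qquad A_2=1+w_1\bar w_1+w_2\bar w_2,$$ together with their complex conjugates, and their solutions invariant under the scaling symmetries $S=w_i\partial_{w_i}-\bar w_i\partial_{\bar w_i}$, $i=1,2$. The invariants of these vector fields imply the algebraic constraints $w_i\bar w_i=D_i\in\mathbb{R}$, and without loss of generality $D_i=1$; the invariant solution is then $$w_i=\frac{F_i(\xi)}{\bar F_i(\bar\xi)},\qquad i=1,2,$$ where $F_i$ and $\bar F_i$ are arbitrary complex-valued functions of one complex variable $\xi$ and $\bar\xi$, respectively. Substituting into the model equations, the $F_i$ must satisfy $$|F_2|^2|F_1'|^2=|F_1|^2|F_2'|^2,$$ which implies $F_2'(\xi)=\frac{F_2(\xi)F_1'(\xi)}{F_1(\xi)}e^{i\psi}$ with $\psi$ a constant, with solution $$F_2(\xi)=c\,F_1(\xi)^{e^{i\psi}},\qquad c\in\mathbb{C},$$ and, by the model equations, $\psi$ must satisfy $$\psi=\pm\frac{\pi}{3}+2\pi m,\qquad m\in\mathbb{Z}.$$ Thus one obtains a class of scaling-invariant solutions of the $\mathbb{C}P^2$ model equations depending on one arbitrary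 complex-valued function $F_1$ of one variable $\xi$ and its conjugate: $$w_1=\frac{F_1(\xi)}{\bar F_1(\bar\xi)},\qquad w_2=\frac{c}{\bar c}\,\frac{F_1(\xi)^{e^{i\psi}}}{\bar F_1(\bar\xi)^{e^{-i\psi}}} .$$
   Context: $\partial=\partial/\partial\xi$ and $\bar\partial=\partial/\partial\bar\xi$ are the Wirtinger derivatives with respect to the complex variable $\xi$, which ranges over an open connected subset of $\mathbb{C}$; $w_1,w_2$ are complex-valued functions of $(\xi,\bar\xi)$ and $\bar w_i$ are their complex conjugates; $\bar F_i(\bar\xi)$ is the complex conjugate of $F_i(\xi)$; a prime denotes differentiation with respect to the argument ($\xi$ or $\bar\xi$).
   Formalization: D_i=1 is assumed, not "without loss of generality" (false: D_1=D_2=D gives cos ψ=1/(2D)); the F_i are obtained on simply connected subdomains (global ones may not exist); "ψ must satisfy" assumes F_1 nonconstant; the power in the final class uses a holomorphic branch of log F_1 on the domain. *)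

theory Defs
  imports "HOL-Complex_Analysis.Complex_Analysis"
begin

section \<open>Wirtinger derivatives\<close>

definition wirt :: "(complex \<Rightarrow> complex) \<Rightarrow> complex \<Rightarrow> complex" where
  "wirt f z = (frechet_derivative f (at z) 1 - \<i> * frechet_derivative f (at z) \<i>) / 2"

definition wirt_bar :: "(complex \<Rightarrow> complex) \<Rightarrow> complex \<Rightarrow> complex" where
  "wirt_bar f z = (frechet_derivative f (at z) 1 + \<i> * frechet_derivative f (at z) \<i>) / 2"

text \<open>Twice continuously differentiable in the real sense, as a function of
  \<open>(\<xi>, \<xi>-bar)\<close>; meant for open \<open>\<Omega>\<close>.\<close>

definition C2_on :: "complex set \<Rightarrow> (complex \<Rightarrow> complex) \<Rightarrow> bool" where
  "C2_on \<Omega> f \<longleftrightarrow>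
     f differentiable_on \<Omega> \<and>
     wirt f differentiable_on \<Omega> \<and> wirt_bar f differentiable_on \<Omega> \<and>
     continuous_on \<Omega> (wirt (wirt f)) \<and> continuous_on \<Omega> (wirt (wirt_bar f)) \<and>
     continuous_on \<Omega> (wirt_bar (wirt f)) \<and> continuous_on \<Omega> (wirt_bar (wirt_bar f))"

section \<open>The sigma model equations\<close>

definition A2 :: "(complex \<Rightarrow> complex) \<Rightarrow> (complex \<Rightarrow> complex) \<Rightarrow> complex \<Rightarrow> complex" where
  "A2 w1 w2 \<xi> = 1 + w1 \<xi> * cnj (w1 \<xi>) + w2 \<xi> * cnj (w2 \<xi>)"

text \<open>The equation for \<open>w1\<close>; the equation for \<open>w2\<close> is the same with the indices exchanged.\<close>

definition cp2_eq :: "(complex \<Rightarrow> complex) \<Rightarrow> (complex \<Rightarrow> complex) \<Rightarrow> complex \<Rightarrow> bool" where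
  "cp2_eq w1 w2 \<xi> \<longleftrightarrow>
     wirt (wirt_bar w1) \<xi>
     - 2 * cnj (w1 \<xi>) / A2 w1 w2 \<xi> * wirt w1 \<xi> * wirt_bar w1 \<xi>
     - cnj (w2 \<xi>) / A2 w1 w2 \<xi> *
         (wirt w1 \<xi> * wirt_bar w2 \<xi> + wirt_bar w1 \<xi> * wirt w2 \<xi>) = 0"

definition cp2_eq_cnj :: "(complex \<Rightarrow> complex) \<Rightarrow> (complex \<Rightarrow> complex) \<Rightarrow> complex \<Rightarrow> bool" where
  "cp2_eq_cnj w1 w2 \<xi> \<longleftrightarrow>
     wirt_bar (wirt (cnj \<circ> w1)) \<xi>
     - 2 * w1 \<xi> / A2 w1 w2 \<xi> * wirt_bar (cnj \<circ> w1) \<xi> * wirt (cnj \<circ> w1) \<xi>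
     - w2 \<xi> / A2 w1 w2 \<xi> *
         (wirt_bar (cnj \<circ> w1) \<xi> * wirt (cnj \<circ> w2) \<xi>
          + wirt (cnj \<circ> w1) \<xi> * wirt_bar (cnj \<circ> w2) \<xi>) = 0"

definition cp2_solution ::
  "complex set \<Rightarrow> (complex \<Rightarrow> complex) \<Rightarrow> (complex \<Rightarrow> complex) \<Rightarrow> bool" where
  "cp2_solution \<Omega> w1 w2 \<longleftrightarrow>
     C2_on \<Omega> w1 \<and> C2_on \<Omega> w2 \<and>
     (\<forall>\<xi>\<in>\<Omega>. cp2_eq w1 w2 \<xi> \<and> cp2_eq w2 w1 \<xi> \<and> cp2_eq_cnj w1 w2 \<xi> \<and> cp2_eq_cnj w2 w1 \<xi>)"

section \<open>Scaling invariance\<close>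

text \<open>The vector fields \<open>S = w\<^sub>i \<partial>/\<partial>w\<^sub>i - cnj w\<^sub>i \<partial>/\<partial>(cnj w\<^sub>i)\<close>, \<open>i = 1, 2\<close>, acting on
  functions of the dependent variables \<open>(w\<^sub>1, w\<^sub>2)\<close>.\<close>

definition S1 :: "(complex \<times> complex \<Rightarrow> complex) \<Rightarrow> complex \<times> complex \<Rightarrow> complex" where
  "S1 \<Phi> = (\<lambda>(u, v). u * wirt (\<lambda>x. \<Phi> (x, v)) u - cnj u * wirt_bar (\<lambda>x. \<Phi> (x, v)) u)"

definition S2 :: "(complex \<times> complex \<Rightarrow> complex) \<Rightarrow> complex \<times> complex \<Rightarrow> complex" where
  "S2 \<Phi> = (\<lambda>(u, v). v * wirt (\<lambda>y. \<Phi> (u, y)) v - cnj v * wirt_bar (\<lambda>y. \<Phi> (u, y)) v)"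

definition scaling_invariant_function :: "(complex \<times> complex \<Rightarrow> complex) \<Rightarrow> bool" where
  "scaling_invariant_function \<Phi> \<longleftrightarrow>
     \<Phi> differentiable_on UNIV \<and> (\<forall>p. S1 \<Phi> p = 0) \<and> (\<forall>p. S2 \<Phi> p = 0)"

text \<open>A pair \<open>(w1, w2)\<close> is scaling invariant if the invariants of the two vector fields are
  constant along it. (Requiring the functions \<open>w1\<close>, \<open>w2\<close> themselves to be unchanged by the flow
  would only leave \<open>w1 = w2 = 0\<close>.)\<close>

definition scaling_invariant ::
  "complex set \<Rightarrow> (complex \<Rightarrow> complex) \<Rightarrow> (complex \<Rightarrow> complex) \<Rightarrow> bool" where
  "scaling_invariant \<Omega> w1 w2 \<longleftrightarrow>
     (\<forall>\<Phi>. scaling_invariant_function \<Phi> \<longrightarrow> (\<lambda>\<xi>. \<Phi> (w1 \<xi>, w2 \<xi>)) constant_on \<Omega>)"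

section \<open>Functions of one complex variable and their powers\<close>

definition holo_nonzero :: "complex set \<Rightarrow> (complex \<Rightarrow> complex) \<Rightarrow> bool" where
  "holo_nonzero \<Omega> F \<longleftrightarrow> F holomorphic_on \<Omega> \<and> (\<forall>\<xi>\<in>\<Omega>. F \<xi> \<noteq> 0)"

definition phase_quot :: "(complex \<Rightarrow> complex) \<Rightarrow> complex \<Rightarrow> complex" where
  "phase_quot F \<xi> = F \<xi> / cnj (F \<xi>)"

text \<open>The principal power \<open>powr\<close> is discontinuous where \<open>F\<close> crosses the negative real axis, so
  \<open>F(\<xi>)\<^sup>\<alpha>\<close> is read as \<open>exp (\<alpha> * L \<xi>)\<close> for a holomorphic branch \<open>L\<close> of \<open>log F\<close>; the power of the
  conjugate function is then taken with the conjugate branch \<open>cnj (L \<xi>)\<close>.\<close>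

definition log_branch :: "complex set \<Rightarrow> (complex \<Rightarrow> complex) \<Rightarrow> (complex \<Rightarrow> complex) \<Rightarrow> bool" where
  "log_branch \<Omega> F L \<longleftrightarrow> L holomorphic_on \<Omega> \<and> (\<forall>\<xi>\<in>\<Omega>. exp (L \<xi>) = F \<xi>)"

definition branch_power :: "(complex \<Rightarrow> complex) \<Rightarrow> complex \<Rightarrow> complex \<Rightarrow> complex" where
  "branch_power L \<alpha> \<xi> = exp (\<alpha> * L \<xi>)"

definition admissible_angle :: "real \<Rightarrow> bool" where
  "admissible_angle \<psi> \<longleftrightarrow>
     (\<exists>m::int. \<psi> = pi / 3 + 2 * pi * of_int m \<or> \<psi> = - (pi / 3) + 2 * pi * of_int m)"

end

theory Submission
  imports Defs
begin

text \<open>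
  Write \<open>a\<close>, \<open>b\<close> for the logarithmic derivatives of \<open>F1\<close>, \<open>F2\<close>. For \<open>w\<^sub>i = F\<^sub>i / cnj F\<^sub>i\<close> one has
  \<open>A2 = 3\<close>, and the two equations reduce to \<open>\<bar>a\<bar>\<^sup>2 = 2 Re (a cnj b)\<close> and \<open>\<bar>b\<bar>\<^sup>2 = 2 Re (a cnj b)\<close>. Hence
  \<open>\<bar>a\<bar> = \<bar>b\<bar>\<close>, so \<open>b = a exp (i \<psi>)\<close> with constant \<open>\<psi>\<close> by the maximum principle, and \<open>2 cos \<psi> = 1\<close>
  unless \<open>a\<close> vanishes identically. Conversely, for a unimodular solution \<open>w = exp (i \<theta>)\<close> the imaginary
  part of the equation divided by \<open>w\<close> says that the phase \<open>\<theta>\<close> is harmonic, so that \<open>wirt w / w\<close> is holomorphic and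
  \<open>w\<close> has the form \<open>F / cnj F\<close> on simply connected sets.
\<close>

section \<open>Symmetry of mixed second derivatives\<close>

text \<open>The second difference is the increment over \<open>[0, t]\<close> of the first
  difference in direction \<open>v\<close>, moved along \<open>u\<close>. Differentiability of
  \<open>f' x u\<close> at \<open>z\<close> makes the derivative of that path equal to
  \<open>t *\<^sub>R D v\<close> up to an error of order \<open>e * t\<close>, and the mean value
  inequality supplies the second factor \<open>t\<close>.\<close>

lemma second_difference_bound:
  fixes f :: "'a::real_normed_vector \<Rightarrow> 'b::real_normed_vector"
  assumes "open S" "z \<in> S"
    and f: "\<And>x. x \<in> S \<Longrightarrow> (f has_derivative f' x) (at x)"
    and D: "((\<lambda>x. f' x u) has_derivative D) (at z)"
    and "e > 0"
  shows "\<exists>d>0. \<forall>t. 0 < t \<and> t < d \<longrightarrow>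
    norm (f (z + t *\<^sub>R u + t *\<^sub>R v) - f (z + t *\<^sub>R u) - f (z + t *\<^sub>R v) + f z
      - t\<^sup>2 *\<^sub>R D v) \<le> e * t\<^sup>2"
proof -
  \<comment> \<open>\<open>t * K\<close> bounds the distance from \<open>z\<close> to every point of
    the parallelogram spanned by \<open>t u\<close> and \<open>t v\<close>; the summand 1 keeps
    \<open>K\<close> positive when both directions vanish.\<close>
  define K where "K = 1 + norm u + norm v"
  have K: "K > 0" unfolding K_def by (smt (verit) norm_ge_zero)
  interpret D: bounded_linear D using D by (rule has_derivative_bounded_linear)
  \<comment> \<open>The tolerance \<open>e / (2 * K)\<close> is used at two points at distance at
    most \<open>t * K\<close>, and so costs \<open>e * t / 2\<close> at each.\<close>
  obtain d1 where d1: "d1 > 0" "\<And>y. norm (y - z) < d1 \<Longrightarrow>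
      norm (f' y u - f' z u - D (y - z)) \<le> (e / (2 * K)) * norm (y - z)"
    using D \<open>e > 0\<close> K unfolding has_derivative_at_alt
    by (metis divide_pos_pos mult_pos_pos zero_less_numeral)
  obtain d2 where d2: "d2 > 0" "ball z d2 \<subseteq> S"
    using assms(1,2) open_contains_ball by blast
  define d where "d = min d1 d2 / K"
  have "d > 0" using d1(1) d2(1) K by (simp add: d_def)
  moreover have "norm (f (z + t *\<^sub>R u + t *\<^sub>R v) - f (z + t *\<^sub>R u) - f (z + t *\<^sub>R v) + f z
      - t\<^sup>2 *\<^sub>R D v) \<le> e * t\<^sup>2" if t: "0 < t" "t < d" for t
  proof -
    have tK: "t * K < d1" "t * K < d2"
      using t K by (auto simp: d_def pos_less_divide_eq)
    have small: "norm (s *\<^sub>R u + r *\<^sub>R v) \<le> t * K" if "0 \<le> s" "s \<le> t" "0 \<le> r" "r \<le> t" for s r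
    proof -
      have "norm (s *\<^sub>R u + r *\<^sub>R v) \<le> s * norm u + r * norm v"
        using norm_triangle_ineq[of "s *\<^sub>R u" "r *\<^sub>R v"] that by simp
      also have "\<dots> \<le> t * norm u + t * norm v"
        using that by (intro add_mono mult_right_mono) auto
      also have "\<dots> \<le> t * K" using t by (simp add: K_def distrib_left)
      finally show ?thesis .
    qed
    have "dist z (z + x) = norm x" for x
      by (metis add_diff_cancel_left' dist_commute dist_norm)
    then have inS: "z + (s *\<^sub>R u + r *\<^sub>R v) \<in> S" if "0 \<le> s" "s \<le> t" "0 \<le> r" "r \<le> t" for s r
      using small[OF that] tK d2(2) by (intro subsetD[OF d2(2)]) simp
    \<comment> \<open>Subtracting the linear term beforehand makes the increment of
      \<open>\<phi>\<close> over \<open>[0, t]\<close> exactly the quantity to be estimated.\<close>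
    define \<phi> where "\<phi> = (\<lambda>s. f (z + s *\<^sub>R u + t *\<^sub>R v) - f (z + s *\<^sub>R u) - s *\<^sub>R (t *\<^sub>R D v))"
    define \<phi>' where "\<phi>' = (\<lambda>s. f' (z + s *\<^sub>R u + t *\<^sub>R v) u - f' (z + s *\<^sub>R u) u - t *\<^sub>R D v)"
    have der: "(\<phi> has_derivative (\<lambda>h. h *\<^sub>R \<phi>' s)) (at s within {0..t})" if s: "s \<in> {0..t}" for s
    proof -
      have 1: "z + s *\<^sub>R u + t *\<^sub>R v \<in> S" using inS[of s t] s t by (simp add: add.assoc)
      have 2: "z + s *\<^sub>R u \<in> S" using inS[of s 0] s t by simp
      have a: "((\<lambda>s. f (z + s *\<^sub>R u + t *\<^sub>R v)) has_derivative
               (\<lambda>h. f' (z + s *\<^sub>R u + t *\<^sub>R v) (h *\<^sub>R u))) (at s within {0..t})"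
        by (rule has_derivative_compose[where f = "\<lambda>s. z + s *\<^sub>R u + t *\<^sub>R v", OF _ f[OF 1]]) (auto intro!: derivative_eq_intros)
      have b: "((\<lambda>s. f (z + s *\<^sub>R u)) has_derivative
               (\<lambda>h. f' (z + s *\<^sub>R u) (h *\<^sub>R u))) (at s within {0..t})"
        by (rule has_derivative_compose[where f = "\<lambda>s. z + s *\<^sub>R u", OF _ f[OF 2]]) (auto intro!: derivative_eq_intros)
      have l1: "linear (f' (z + s *\<^sub>R u + t *\<^sub>R v))" using f[OF 1] by (rule has_derivative_linear)
      have l2: "linear (f' (z + s *\<^sub>R u))" using f[OF 2] by (rule has_derivative_linear)
      show ?thesis unfolding \<phi>_def \<phi>'_def
        by (rule has_derivative_eq_rhs[OF has_derivative_diff[OF has_derivative_diff[OF a b]]])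
          (auto intro!: derivative_eq_intros simp: linear_scale[OF l1] linear_scale[OF l2] scaleR_diff_right)
    qed
    have bound: "norm (\<phi>' s) \<le> e * t" if s: "s \<in> {0..t}" for s
    proof -
      have near: "norm (f' (z + x) u - f' z u - D x) \<le> e / (2 * K) * (t * K)"
        if "norm x \<le> t * K" for x
      proof -
        have "norm (f' (z + x) u - f' z u - D x) \<le> e / (2 * K) * norm x"
          using d1(2)[of "z + x"] that tK by simp
        also have "\<dots> \<le> e / (2 * K) * (t * K)"
          using that \<open>e > 0\<close> K by (intro mult_left_mono) auto
        finally show ?thesis .
      qed
      have 1: "norm (f' (z + (s *\<^sub>R u + t *\<^sub>R v)) u - f' z u - D (s *\<^sub>R u + t *\<^sub>R v)) \<le> e * t / 2"
        using near[OF small[of s t]] s t K by simp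
      have 2: "norm (f' (z + s *\<^sub>R u) u - f' z u - D (s *\<^sub>R u)) \<le> e * t / 2"
        using near[OF small[of s 0]] s t K by simp
      \<comment> \<open>Linearity of \<open>D\<close> splits the error into the two linearisation
        errors at the points \<open>z + s u + t v\<close> and \<open>z + s u\<close>.\<close>
      have "\<phi>' s = (f' (z + (s *\<^sub>R u + t *\<^sub>R v)) u - f' z u - D (s *\<^sub>R u + t *\<^sub>R v))
            - (f' (z + s *\<^sub>R u) u - f' z u - D (s *\<^sub>R u))"
        by (simp add: \<phi>'_def D.add D.scaleR add.assoc)
      then show ?thesis
        using norm_triangle_ineq4 1 2 by (smt (verit) field_sum_of_halves)
    qed
    have "norm (\<phi> t - \<phi> 0) \<le> (e * t) * norm (t - 0)"
    proof (rule differentiable_bound[OF _ der])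
      show "onorm (\<lambda>h. h *\<^sub>R \<phi>' s) \<le> e * t" if "s \<in> {0..t}" for s
        by (rule onorm_bound) (use bound[OF that] \<open>e > 0\<close> t in
            \<open>auto simp: mult.commute intro!: mult_left_mono\<close>)
    qed (use t in auto)
    moreover have "\<phi> t - \<phi> 0 = f (z + t *\<^sub>R u + t *\<^sub>R v) - f (z + t *\<^sub>R u) - f (z + t *\<^sub>R v) + f z
      - t\<^sup>2 *\<^sub>R D v"
      by (simp add: \<phi>_def power2_eq_square)
    ultimately show ?thesis using t by (simp add: power2_eq_square mult.assoc)
  qed
  ultimately show ?thesis by blast
qed

text \<open>The second difference is symmetric in \<open>u\<close> and \<open>v\<close>, so
  \<open>t\<^sup>2 *\<^sub>R D v\<close> and \<open>t\<^sup>2 *\<^sub>R E u\<close> approximate one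
  and the same quantity. Dividing by \<open>t\<^sup>2\<close> makes \<open>D v\<close> and
  \<open>E u\<close> arbitrarily close.\<close>

lemma mixed_derivatives_eq:
  fixes f :: "'a::real_normed_vector \<Rightarrow> 'b::real_normed_vector"
  assumes "open S" "z \<in> S"
    and f: "\<And>x. x \<in> S \<Longrightarrow> (f has_derivative f' x) (at x)"
    and D: "((\<lambda>x. f' x u) has_derivative D) (at z)"
    and E: "((\<lambda>x. f' x v) has_derivative E) (at z)"
  shows "D v = E u"
proof -
  have "norm (D v - E u) \<le> e" if "e > 0" for e
  proof -
    from that have e2: "e / 2 > 0" by simp
    obtain d1 where d1: "d1 > 0" "\<And>t. 0 < t \<and> t < d1 \<Longrightarrow>
        norm (f (z + t *\<^sub>R u + t *\<^sub>R v) - f (z + t *\<^sub>R u) - f (z + t *\<^sub>R v) + f z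
      - t\<^sup>2 *\<^sub>R D v) \<le> e / 2 * t\<^sup>2"
      using second_difference_bound[OF assms(1,2) f D e2, of v] by blast
    obtain d2 where d2: "d2 > 0" "\<And>t. 0 < t \<and> t < d2 \<Longrightarrow>
        norm (f (z + t *\<^sub>R v + t *\<^sub>R u) - f (z + t *\<^sub>R v) - f (z + t *\<^sub>R u) + f z
      - t\<^sup>2 *\<^sub>R E u) \<le> e / 2 * t\<^sup>2"
      using second_difference_bound[OF assms(1,2) f E e2, of u] by blast
    define t where "t = min d1 d2 / 2"
    have t: "0 < t" "t < d1" "t < d2" using d1 d2 by (auto simp: t_def)
    define \<Delta> where "\<Delta> = f (z + t *\<^sub>R u + t *\<^sub>R v) - f (z + t *\<^sub>R u) - f (z + t *\<^sub>R v) + f z"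
    have \<Delta>: "f (z + t *\<^sub>R v + t *\<^sub>R u) - f (z + t *\<^sub>R v) - f (z + t *\<^sub>R u) + f z = \<Delta>"
      by (simp add: \<Delta>_def algebra_simps)
    have 1: "norm (\<Delta> - t\<^sup>2 *\<^sub>R D v) \<le> e / 2 * t\<^sup>2" using d1(2)[of t] t by (simp add: \<Delta>_def)
    have 2: "norm (\<Delta> - t\<^sup>2 *\<^sub>R E u) \<le> e / 2 * t\<^sup>2" using d2(2)[of t] t unfolding \<Delta> by simp
    have "t\<^sup>2 *\<^sub>R (D v - E u) = (\<Delta> - t\<^sup>2 *\<^sub>R E u) - (\<Delta> - t\<^sup>2 *\<^sub>R D v)"
      by (simp add: algebra_simps)
    then have "norm (t\<^sup>2 *\<^sub>R (D v - E u)) \<le> e * t\<^sup>2"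
      using norm_triangle_ineq4[of "\<Delta> - t\<^sup>2 *\<^sub>R E u" "\<Delta> - t\<^sup>2 *\<^sub>R D v"] 1 2 by simp
    then show ?thesis using t by simp
  qed
  then have "norm (D v - E u) \<le> 0" by (rule field_le_epsilon[of _ 0, simplified]) 
  then show ?thesis by simp
qed

section \<open>Calculus of Wirtinger derivatives\<close>

text \<open>Every real-linear map of the plane is \<open>p * h + q * cnj h\<close> for unique
  \<open>p\<close> and \<open>q\<close>. Recording differentiability together with both coefficients
  gives a calculus free of side conditions, and \<open>q = 0\<close> is complex
  differentiability.\<close>

definition has_wirt :: "(complex \<Rightarrow> complex) \<Rightarrow> complex \<Rightarrow> complex \<Rightarrow> complex \<Rightarrow> bool" where
  "has_wirt f p q z \<longleftrightarrow> (f has_derivative (\<lambda>h. p * h + q * cnj h)) (at z)"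

lemma has_wirt_imp:
  assumes "has_wirt f p q z"
  shows "wirt f z = p" "wirt_bar f z = q" "f differentiable (at z)"
proof -
  have "frechet_derivative f (at z) = (\<lambda>h. p * h + q * cnj h)"
    using assms unfolding has_wirt_def by (rule frechet_derivative_at[symmetric])
  then show "wirt f z = p" "wirt_bar f z = q"
    by (auto simp: wirt_def wirt_bar_def algebra_simps)
  show "f differentiable (at z)" using assms unfolding has_wirt_def differentiable_def by blast
qed

lemma differentiable_imp_has_wirt:
  assumes "f differentiable (at z)"
  shows "has_wirt f (wirt f z) (wirt_bar f z) z"
proof -
  let ?D = "frechet_derivative f (at z)"
  have d: "(f has_derivative ?D) (at z)" using assms frechet_derivative_works by blast
  then have lin: "linear ?D" by (rule has_derivative_linear)
  have "?D h = wirt f z * h + wirt_bar f z * cnj h" for h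
  proof -
    have "?D h = ?D (Re h *\<^sub>R 1 + Im h *\<^sub>R \<i>)"
      by (rule arg_cong[of _ _ ?D]) (simp add: complex_eq_iff)
    also have "\<dots> = Re h *\<^sub>R ?D 1 + Im h *\<^sub>R ?D \<i>"
      by (simp only: linear_add[OF lin] linear_scale[OF lin])
    also have "\<dots> = wirt f z * h + wirt_bar f z * cnj h"
      by (simp add: complex_eq_iff wirt_def wirt_bar_def field_simps)
    finally show ?thesis .
  qed
  then have "?D = (\<lambda>h. wirt f z * h + wirt_bar f z * cnj h)" by (rule ext)
  with d show ?thesis unfolding has_wirt_def by simp
qed

lemma has_wirt_mult:
  assumes "has_wirt f p q z" "has_wirt g r s z"
  shows "has_wirt (\<lambda>x. f x * g x) (p * g z + f z * r) (q * g z + f z * s) z"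
  using has_derivative_mult[OF assms[unfolded has_wirt_def]] unfolding has_wirt_def
  by (rule has_derivative_eq_rhs) (auto simp: algebra_simps)

lemma has_wirt_cnj:
  assumes "has_wirt f p q z"
  shows "has_wirt (\<lambda>x. cnj (f x)) (cnj q) (cnj p) z"
  using has_derivative_cnj[OF assms[unfolded has_wirt_def]] unfolding has_wirt_def
  by (rule has_derivative_eq_rhs) (auto simp: algebra_simps)

lemma has_wirt_minus:
  assumes "has_wirt f p q z"
  shows "has_wirt (\<lambda>x. - f x) (- p) (- q) z"
  using has_derivative_minus[OF assms[unfolded has_wirt_def]] unfolding has_wirt_def
  by (rule has_derivative_eq_rhs) (auto simp: algebra_simps)

lemma has_wirt_transform:
  assumes "has_wirt f p q z" "open S" "z \<in> S" "\<And>x. x \<in> S \<Longrightarrow> f x = g x"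
  shows "has_wirt g p q z"
  using assms unfolding has_wirt_def by (blast intro: has_derivative_transform_within_open)

lemma has_field_derivative_iff_has_wirt:
  "(f has_field_derivative d) (at z) \<longleftrightarrow> has_wirt f d 0 z"
  unfolding has_wirt_def has_field_derivative_def by simp

lemma holomorphic_has_wirt:
  assumes "f holomorphic_on S" "open S" "z \<in> S"
  shows "has_wirt f (deriv f z) 0 z"
  using holomorphic_derivI[OF assms, of UNIV] by (simp add: has_field_derivative_iff_has_wirt)

lemma has_wirt_unique:
  assumes "has_wirt f p q z" "has_wirt f p' q' z"
  shows "p = p'" "q = q'"
  using assms has_wirt_imp by metis+

lemma wirt_wirt_bar_commute:
  assumes "open S" "z \<in> S" "f differentiable_on S"
    and "wirt f differentiable_on S" "wirt_bar f differentiable_on S"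
  shows "wirt (wirt_bar f) z = wirt_bar (wirt f) z"
proof -
  have diff: "has_wirt g (wirt g x) (wirt_bar g x) x" if "g differentiable_on S" "x \<in> S" for g x
    using that assms(1) by (metis differentiable_imp_has_wirt differentiable_on_eq_differentiable_at)
  define P Q where "P = wirt f" and "Q = wirt_bar f"
  have P: "(P has_derivative (\<lambda>h. wirt P z * h + wirt_bar P z * cnj h)) (at z)"
    using diff[OF assms(4,2)] by (simp add: P_def has_wirt_def)
  have Q: "(Q has_derivative (\<lambda>h. wirt Q z * h + wirt_bar Q z * cnj h)) (at z)"
    using diff[OF assms(5,2)] by (simp add: Q_def has_wirt_def)
  have f: "(f has_derivative (\<lambda>h. P x * h + Q x * cnj h)) (at x)" if "x \<in> S" for x
    using diff[OF assms(3) that] by (simp add: P_def Q_def has_wirt_def)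
  \<comment> \<open>The directional derivatives of \<open>f\<close> along 1 and \<open>\<i>\<close>
    are \<open>P + Q\<close> and \<open>\<i> * (P - Q)\<close>. In the symmetry of their mixed
    derivatives the terms \<open>wirt P z\<close> and \<open>wirt_bar Q z\<close> cancel.\<close>
  have "(wirt P z * \<i> + wirt_bar P z * cnj \<i>) * 1 + (wirt Q z * \<i> + wirt_bar Q z * cnj \<i>) * cnj 1
      = (wirt P z * 1 + wirt_bar P z * cnj 1) * \<i> + (wirt Q z * 1 + wirt_bar Q z * cnj 1) * cnj \<i>"
    by (rule mixed_derivatives_eq[OF assms(1,2) f, of 1 _ \<i>])
      (assumption | intro has_derivative_add has_derivative_mult_left P Q)+
  then have "\<i> * (2 * wirt Q z) = \<i> * (2 * wirt_bar P z)"
    by (simp add: algebra_simps)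
  then show ?thesis by (simp add: P_def Q_def)
qed

section \<open>Scaling invariance\<close>

text \<open>The derivative of \<open>g\<close> along the circle \<open>r * cis s\<close> is
  \<open>\<i>\<close> times the expression in \<open>inv\<close>. It vanishes, so \<open>g\<close>
  is constant on each circle around 0.\<close>

lemma rotation_invariant_depends_on_norm:
  assumes g: "\<And>u. g differentiable (at u)"
    and inv: "\<And>u. u * wirt g u - cnj u * wirt_bar g u = 0"
    and "cmod u = cmod v"
  shows "g u = g v"
proof -
  have v: "g (of_real r * cis t) = g (of_real r)" for r t
  proof -
    have "((\<lambda>s. g (of_real r * cis s)) has_derivative (\<lambda>h. 0)) (at s within UNIV)" for s
    proof -
      let ?x = "of_real r * cis s"
      have 1: "(g has_derivative (\<lambda>h. wirt g ?x * h + wirt_bar g ?x * cnj h)) (at ?x)"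
        using differentiable_imp_has_wirt[OF g] by (simp add: has_wirt_def)
      have 2: "((\<lambda>s. of_real r * cis s) has_derivative (\<lambda>h. of_real h * (\<i> * ?x))) (at s)"
      proof -
        have "((\<lambda>s. of_real r * exp (\<i> * of_real s)) has_vector_derivative (\<i> * ?x)) (at s)"
          by (rule has_vector_derivative_real_field)
            (auto intro!: derivative_eq_intros simp: cis_conv_exp)
        then show ?thesis
          by (simp add: has_vector_derivative_def scaleR_conv_of_real cis_conv_exp)
      qed
      have "wirt g ?x * (of_real h * (\<i> * ?x)) + wirt_bar g ?x * cnj (of_real h * (\<i> * ?x))
         = of_real h * \<i> * (?x * wirt g ?x - cnj ?x * wirt_bar g ?x)" for h
        by (simp add: algebra_simps)
      then show ?thesis using has_derivative_compose[OF 2 1] by (simp only: inv) simp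
    qed
    from has_derivative_zero_unique[OF convex_UNIV this, of t 0] show ?thesis by simp
  qed
  show ?thesis
    using v[of "cmod u" "Arg u"] v[of "cmod v" "Arg v"] assms(3) rcis_cmod_Arg[of u] rcis_cmod_Arg[of v]
    by (simp add: rcis_def)
qed

text \<open>The two arguments are rotated one after the other, the first by \<open>S1\<close> and
  the second by \<open>S2\<close>.\<close>

lemma scaling_invariant_function_depends_on_norms:
  assumes "scaling_invariant_function \<Phi>" "cmod u = cmod u'" "cmod v = cmod v'"
  shows "\<Phi> (u, v) = \<Phi> (u', v')"
proof -
  have d: "\<Phi> differentiable (at p)" for p
    using assms(1) by (cases p) (simp add: scaling_invariant_function_def differentiable_on_def)
  have "\<Phi> (u, v) = \<Phi> (u', v)"
  proof (rule rotation_invariant_depends_on_norm[of "\<lambda>x. \<Phi> (x, v)", OF _ _ assms(2)])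
    show "(\<lambda>x. \<Phi> (x, v)) differentiable (at x)" for x
      by (rule differentiable_compose[OF d, of "\<lambda>x. (x, v)"])
        (auto simp: differentiable_def intro!: exI derivative_eq_intros)
    show "x * wirt (\<lambda>x. \<Phi> (x, v)) x - cnj x * wirt_bar (\<lambda>x. \<Phi> (x, v)) x = 0" for x
      using assms(1) by (auto simp: scaling_invariant_function_def S1_def)
  qed
  also have "\<dots> = \<Phi> (u', v')"
  proof (rule rotation_invariant_depends_on_norm[of "\<lambda>y. \<Phi> (u', y)", OF _ _ assms(3)])
    show "(\<lambda>y. \<Phi> (u', y)) differentiable (at y)" for y
      by (rule differentiable_compose[OF d, of "\<lambda>y. (u', y)"])
        (auto simp: differentiable_def intro!: exI derivative_eq_intros)
    show "y * wirt (\<lambda>y. \<Phi> (u', y)) y - cnj y * wirt_bar (\<lambda>y. \<Phi> (u', y)) y = 0" for y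
      using assms(1) by (auto simp: scaling_invariant_function_def S2_def)
  qed
  finally show ?thesis .
qed

lemma wirt_norm_square:
  "wirt (\<lambda>x. x * cnj x) u = cnj u" "wirt_bar (\<lambda>x. x * cnj x) u = u"
proof -
  have "has_wirt (\<lambda>x. x) 1 0 u" by (simp add: has_wirt_def)
  from has_wirt_mult[OF this has_wirt_cnj[OF this]]
  have "has_wirt (\<lambda>x. x * cnj x) (cnj u) u u" by simp
  then show "wirt (\<lambda>x. x * cnj x) u = cnj u" "wirt_bar (\<lambda>x. x * cnj x) u = u"
    by (rule has_wirt_imp)+
qed

lemma wirt_const: "wirt (\<lambda>x. c) u = 0" "wirt_bar (\<lambda>x. c) u = 0"
  by (simp_all add: wirt_def wirt_bar_def)

text \<open>The squared moduli of the two variables are themselves invariants, which forces them to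
  be constant along the pair. Conversely every invariant is a function of these moduli
  alone.\<close>

lemma scaling_invariant_iff:
  "scaling_invariant \<Omega> w1 w2 \<longleftrightarrow>
    (\<exists>D1 D2 :: real. \<forall>\<xi>\<in>\<Omega>. w1 \<xi> * cnj (w1 \<xi>) = of_real D1 \<and> w2 \<xi> * cnj (w2 \<xi>) = of_real D2)"
  (is "_ \<longleftrightarrow> ?R")
proof
  assume inv: "scaling_invariant \<Omega> w1 w2"
  have c1: "scaling_invariant_function (\<lambda>p. fst p * cnj (fst p))"
    unfolding scaling_invariant_function_def S1_def S2_def
    by (auto simp: wirt_norm_square wirt_const differentiable_on_def differentiable_def
        intro!: exI derivative_eq_intros)
  have c2: "scaling_invariant_function (\<lambda>p. snd p * cnj (snd p))"
    unfolding scaling_invariant_function_def S1_def S2_def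
    by (auto simp: wirt_norm_square wirt_const differentiable_on_def differentiable_def
        intro!: exI derivative_eq_intros)
  have real: "\<exists>D::real. \<forall>\<xi>\<in>\<Omega>. w \<xi> * cnj (w \<xi>) = of_real D"
    if "(\<lambda>\<xi>. w \<xi> * cnj (w \<xi>)) constant_on \<Omega>" for w
    using that unfolding constant_on_def by (metis complex_norm_square)
  show ?R
    using inv c1 c2 real[of w1] real[of w2] unfolding scaling_invariant_def by fastforce
next
  assume ?R
  then obtain D1 D2 :: real where
    D: "\<And>\<xi>. \<xi> \<in> \<Omega> \<Longrightarrow> w1 \<xi> * cnj (w1 \<xi>) = of_real D1 \<and> w2 \<xi> * cnj (w2 \<xi>) = of_real D2"
    by blast
  have nrm: "cmod (w1 \<xi>) = sqrt D1" "cmod (w2 \<xi>) = sqrt D2" if "\<xi> \<in> \<Omega>" for \<xi>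
    using D[OF that] by (auto simp: complex_norm_square[symmetric] simp flip: of_real_power
      intro!: real_sqrt_unique[symmetric])
  show "scaling_invariant \<Omega> w1 w2"
    unfolding scaling_invariant_def
  proof (intro allI impI)
    fix \<Phi> assume \<Phi>: "scaling_invariant_function \<Phi>"
    have "\<Phi> (w1 x, w2 x) = \<Phi> (w1 y, w2 y)" if "x \<in> \<Omega>" "y \<in> \<Omega>" for x y
      by (rule scaling_invariant_function_depends_on_norms[OF \<Phi>]) (simp_all add: nrm that)
    then show "(\<lambda>\<xi>. \<Phi> (w1 \<xi>, w2 \<xi>)) constant_on \<Omega>"
      unfolding constant_on_def by metis
  qed
qed

section \<open>Quotients \<open>F / cnj F\<close>\<close>

definition log_deriv :: "(complex \<Rightarrow> complex) \<Rightarrow> complex \<Rightarrow> complex" where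
  "log_deriv F \<xi> = deriv F \<xi> / F \<xi>"

lemma phase_quot_nonzero: "F \<xi> \<noteq> 0 \<Longrightarrow> phase_quot F \<xi> \<noteq> 0"
  by (simp add: phase_quot_def)

lemma cnj_phase_quot: "cnj (phase_quot F \<xi>) = inverse (phase_quot F \<xi>)"
  by (simp add: phase_quot_def)

text \<open>Conjugates of quotients are again quotients, with \<open>F\<close> replaced by its
  reciprocal; the conjugate equations are thereby handled by the same derivative formulas.\<close>

lemma phase_quot_inverse: "phase_quot (\<lambda>x. inverse (F x)) = cnj \<circ> phase_quot F"
  by (simp add: phase_quot_def fun_eq_iff field_simps)

lemma holo_nonzero_inverse: "holo_nonzero S F \<Longrightarrow> holo_nonzero S (\<lambda>x. inverse (F x))"
  by (auto simp: holo_nonzero_def intro!: holomorphic_intros)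

lemma log_deriv_inverse:
  assumes "open S" "holo_nonzero S F" "z \<in> S"
  shows "log_deriv (\<lambda>x. inverse (F x)) z = - log_deriv F z"
proof -
  have "(F has_field_derivative deriv F z) (at z)"
    using assms by (meson holo_nonzero_def holomorphic_derivI)
  then have "((\<lambda>x. inverse (F x)) has_field_derivative - (deriv F z / (F z)\<^sup>2)) (at z)"
    using assms by (auto simp: holo_nonzero_def field_simps power2_eq_square intro!: derivative_eq_intros)
  from DERIV_imp_deriv[OF this] show ?thesis
    using assms by (auto simp: log_deriv_def holo_nonzero_def power2_eq_square)
qed

lemma log_deriv_holomorphic:
  assumes "open S" "holo_nonzero S F"
  shows "log_deriv F holomorphic_on S"
  using assms by (auto simp: log_deriv_def[abs_def] holo_nonzero_def intro!: holomorphic_intros)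

text \<open>The quotient is the holomorphic factor \<open>F\<close> times the antiholomorphic factor
  \<open>cnj (inverse F)\<close>. Each Wirtinger derivative sees one factor only, and the two
  logarithmic derivatives are opposite conjugates.\<close>

lemma has_wirt_phase_quot:
  assumes "open S" "holo_nonzero S F" "z \<in> S"
  shows "has_wirt (phase_quot F) (log_deriv F z * phase_quot F z)
    (- cnj (log_deriv F z) * phase_quot F z) z"
proof -
  let ?G = "\<lambda>x. inverse (F x)"
  have 1: "has_wirt F (deriv F z) 0 z"
    using assms holomorphic_has_wirt by (auto simp: holo_nonzero_def)
  have 2: "has_wirt ?G (deriv ?G z) 0 z"
    using holo_nonzero_inverse[OF assms(2)] holomorphic_has_wirt assms(1,3)
    by (auto simp: holo_nonzero_def)
  have nz: "F z \<noteq> 0" using assms by (auto simp: holo_nonzero_def)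
  have dG: "deriv ?G z = - log_deriv F z / F z"
    using log_deriv_inverse[OF assms] nz by (simp add: log_deriv_def field_simps)
  have "phase_quot F = (\<lambda>x. F x * cnj (?G x))" by (simp add: phase_quot_def fun_eq_iff field_simps)
  moreover have "log_deriv F z * phase_quot F z = deriv F z * cnj (?G z) + F z * cnj 0"
    using nz by (simp add: phase_quot_def log_deriv_def field_simps)
  moreover have "- cnj (log_deriv F z) * phase_quot F z = 0 * cnj (?G z) + F z * cnj (deriv ?G z)"
    using nz unfolding dG by (simp add: phase_quot_def)
  ultimately show ?thesis
    using has_wirt_mult[OF 1 has_wirt_cnj[OF 2]] by (simp only:)
qed

text \<open>The first-order formulas hold on the whole open set and are products of \<open>w\<close>
  with a holomorphic or antiholomorphic function, so the product rule applies once more.\<close>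

lemma second_wirt_phase_quot:
  assumes "open S" "holo_nonzero S F" "z \<in> S"
  defines "a \<equiv> log_deriv F" and "w \<equiv> phase_quot F"
  shows "has_wirt (wirt w) (deriv a z * w z + (a z)\<^sup>2 * w z) (- a z * cnj (a z) * w z) z"
    and "has_wirt (wirt_bar w) (- a z * cnj (a z) * w z)
      (- cnj (deriv a z) * w z + (cnj (a z))\<^sup>2 * w z) z"
proof -
  have w: "has_wirt w (a x * w x) (- cnj (a x) * w x) x" if "x \<in> S" for x
    unfolding a_def w_def using has_wirt_phase_quot[OF assms(1,2) that] .
  have a: "has_wirt a (deriv a z) 0 z"
    unfolding a_def using log_deriv_holomorphic[OF assms(1,2)] assms(1,3) by (rule holomorphic_has_wirt)
  have "has_wirt (\<lambda>x. a x * w x) (deriv a z * w z + (a z)\<^sup>2 * w z) (- a z * cnj (a z) * w z) z"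
    using has_wirt_mult[OF a w[OF assms(3)]] by (simp add: power2_eq_square algebra_simps)
  then show "has_wirt (wirt w) (deriv a z * w z + (a z)\<^sup>2 * w z) (- a z * cnj (a z) * w z) z"
    by (rule has_wirt_transform[OF _ assms(1,3)]) (simp add: has_wirt_imp[OF w])
  have "has_wirt (\<lambda>x. - cnj (a x) * w x) (- a z * cnj (a z) * w z)
      (- cnj (deriv a z) * w z + (cnj (a z))\<^sup>2 * w z) z"
    using has_wirt_mult[OF has_wirt_minus[OF has_wirt_cnj[OF a]] w[OF assms(3)]]
    by (simp add: power2_eq_square algebra_simps)
  then show "has_wirt (wirt_bar w) (- a z * cnj (a z) * w z)
      (- cnj (deriv a z) * w z + (cnj (a z))\<^sup>2 * w z) z"
    by (rule has_wirt_transform[OF _ assms(1,3)]) (simp add: has_wirt_imp[OF w])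
qed

lemma C2_on_phase_quot:
  assumes "open S" "holo_nonzero S F"
  shows "C2_on S (phase_quot F)"
proof -
  let ?a = "log_deriv F" and ?w = "phase_quot F"
  note 1 = has_wirt_imp[OF has_wirt_phase_quot[OF assms]]
  note 2 = has_wirt_imp[OF second_wirt_phase_quot(1)[OF assms]]
  note 3 = has_wirt_imp[OF second_wirt_phase_quot(2)[OF assms]]
  have diff: "?w differentiable_on S" "wirt ?w differentiable_on S" "wirt_bar ?w differentiable_on S"
    using 1(3) 2(3) 3(3) by (auto simp: differentiable_on_eq_differentiable_at[OF assms(1)])
  have cont: "continuous_on S ?w" "continuous_on S ?a" "continuous_on S (deriv ?a)"
    using diff(1) log_deriv_holomorphic[OF assms] assms(1)
    by (auto intro: differentiable_imp_continuous_on holomorphic_on_imp_continuous_on holomorphic_deriv)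
  have c1: "continuous_on S (wirt (wirt ?w))"
    by (subst continuous_on_cong[OF refl 2(1)]) (use cont in \<open>auto intro!: continuous_intros\<close>)
  have c2: "continuous_on S (wirt_bar (wirt ?w))"
    by (subst continuous_on_cong[OF refl 2(2)]) (use cont in \<open>auto intro!: continuous_intros\<close>)
  have c3: "continuous_on S (wirt (wirt_bar ?w))"
    by (subst continuous_on_cong[OF refl 3(1)]) (use cont in \<open>auto intro!: continuous_intros\<close>)
  have c4: "continuous_on S (wirt_bar (wirt_bar ?w))"
    by (subst continuous_on_cong[OF refl 3(2)]) (use cont in \<open>auto intro!: continuous_intros\<close>)
  show ?thesis unfolding C2_on_def using diff c1 c2 c3 c4 by blast
qed

section \<open>The model equations as conditions on the logarithmic derivatives\<close>

lemma A2_phase_quot: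
  assumes "F1 z \<noteq> 0" "F2 z \<noteq> 0"
  shows "A2 (phase_quot F1) (phase_quot F2) z = 3"
  using assms by (simp add: A2_def cnj_phase_quot phase_quot_nonzero)

text \<open>With \<open>A2 = 3\<close> all terms carry the factor \<open>w\<close>: the second
  derivative gives \<open>- a * cnj a\<close>, of which the first nonlinear term takes back two
  thirds, and the mixed term adds a third of \<open>a * cnj b + cnj a * b\<close>.\<close>

lemma cp2_eq_phase_quot_iff:
  assumes "open S" "holo_nonzero S F1" "holo_nonzero S F2" "z \<in> S"
  defines "a \<equiv> log_deriv F1 z" and "b \<equiv> log_deriv F2 z"
  shows "cp2_eq (phase_quot F1) (phase_quot F2) z \<longleftrightarrow> a * cnj a = a * cnj b + cnj a * b"
proof -
  define w v where "w = phase_quot F1 z" and "v = phase_quot F2 z"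
  have nz: "F1 z \<noteq> 0" "F2 z \<noteq> 0" using assms by (auto simp: holo_nonzero_def)
  then have wv: "w \<noteq> 0" "v \<noteq> 0" by (simp_all add: w_def v_def phase_quot_nonzero)
  note w = has_wirt_imp[OF has_wirt_phase_quot[OF assms(1,2,4)], folded a_def w_def]
    and v = has_wirt_imp[OF has_wirt_phase_quot[OF assms(1,3,4)], folded b_def v_def]
    and w2 = has_wirt_imp[OF second_wirt_phase_quot(2)[OF assms(1,2,4)], folded a_def w_def]
  have "cp2_eq (phase_quot F1) (phase_quot F2) z \<longleftrightarrow>
    - a * cnj a * w - 2 * inverse w / 3 * (a * w) * (- cnj a * w)
    - inverse v / 3 * ((a * w) * (- cnj b * v) + (- cnj a * w) * (b * v)) = 0"
    unfolding cp2_eq_def w v w2(1) A2_phase_quot[of F1 z F2, OF nz] cnj_phase_quot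
    unfolding w_def v_def ..
  also have "- a * cnj a * w - 2 * inverse w / 3 * (a * w) * (- cnj a * w)
    - inverse v / 3 * ((a * w) * (- cnj b * v) + (- cnj a * w) * (b * v))
    = w * (a * cnj b + cnj a * b - a * cnj a) / 3"
    using wv by (simp add: field_simps)
  also have "\<dots> = 0 \<longleftrightarrow> a * cnj a = a * cnj b + cnj a * b"
    using wv by auto
  finally show ?thesis .
qed

text \<open>Passing to the reciprocals of \<open>F1\<close> and \<open>F2\<close> changes the signs
  of both \<open>a\<close> and \<open>b\<close>, and the condition is quadratic, so it is the same
  as for the original equation.\<close>

lemma cp2_eq_cnj_phase_quot_iff:
  assumes "open S" "holo_nonzero S F1" "holo_nonzero S F2" "z \<in> S"
  defines "a \<equiv> log_deriv F1 z" and "b \<equiv> log_deriv F2 z"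
  shows "cp2_eq_cnj (phase_quot F1) (phase_quot F2) z \<longleftrightarrow> a * cnj a = a * cnj b + cnj a * b"
proof -
  define w v where "w = phase_quot F1 z" and "v = phase_quot F2 z"
  have nz: "F1 z \<noteq> 0" "F2 z \<noteq> 0" using assms by (auto simp: holo_nonzero_def)
  then have wv: "w \<noteq> 0" "v \<noteq> 0" by (simp_all add: w_def v_def phase_quot_nonzero)
  have conj: "(cnj \<circ> phase_quot F1) z = inverse w" "(cnj \<circ> phase_quot F2) z = inverse v"
    by (simp_all add: cnj_phase_quot w_def v_def)
  note G1 = holo_nonzero_inverse[OF assms(2)] and G2 = holo_nonzero_inverse[OF assms(3)]
  note l1 = log_deriv_inverse[OF assms(1,2,4), folded a_def]
    and l2 = log_deriv_inverse[OF assms(1,3,4), folded b_def]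
  note w = has_wirt_imp[OF has_wirt_phase_quot[OF assms(1) G1 assms(4)], unfolded l1 phase_quot_inverse conj]
    and v = has_wirt_imp[OF has_wirt_phase_quot[OF assms(1) G2 assms(4)], unfolded l2 phase_quot_inverse conj]
    and w2 = has_wirt_imp[OF second_wirt_phase_quot(1)[OF assms(1) G1 assms(4)], unfolded l1 phase_quot_inverse conj]
  have "cp2_eq_cnj (phase_quot F1) (phase_quot F2) z \<longleftrightarrow>
    - a * cnj a * inverse w - 2 * w / 3 * (cnj a * inverse w) * (- a * inverse w)
    - v / 3 * ((cnj a * inverse w) * (- b * inverse v) + (- a * inverse w) * (cnj b * inverse v)) = 0"
    unfolding cp2_eq_cnj_def w v w2(2) A2_phase_quot[of F1 z F2, OF nz] 
    unfolding w_def v_def by simp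
  also have "- a * cnj a * inverse w - 2 * w / 3 * (cnj a * inverse w) * (- a * inverse w)
    - v / 3 * ((cnj a * inverse w) * (- b * inverse v) + (- a * inverse w) * (cnj b * inverse v))
    = inverse w * (a * cnj b + cnj a * b - a * cnj a) / 3"
    using wv by (simp add: field_simps)
  also have "\<dots> = 0 \<longleftrightarrow> a * cnj a = a * cnj b + cnj a * b"
    using wv by auto
  finally show ?thesis .
qed

text \<open>The conditions from the two equations share the right-hand side
  \<open>2 * Re (a * cnj b)\<close>, which is symmetric in the indices; together they amount to one
  of them and equality of the moduli.\<close>

lemma cp2_solution_phase_quot_iff:
  assumes "open S" "holo_nonzero S F1" "holo_nonzero S F2"
  shows "cp2_solution S (phase_quot F1) (phase_quot F2) \<longleftrightarrow>
    (\<forall>z\<in>S. cmod (log_deriv F1 z) = cmod (log_deriv F2 z) \<and>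
      (cmod (log_deriv F1 z))\<^sup>2 = 2 * Re (log_deriv F1 z * cnj (log_deriv F2 z)))"
proof -
  have eq: "a * cnj a = a * cnj b + cnj a * b \<longleftrightarrow> (cmod a)\<^sup>2 = 2 * Re (a * cnj b)" for a b
  proof -
    have "a * cnj b + cnj a * b = of_real (2 * Re (a * cnj b))"
      by (simp add: complex_eq_iff)
    then show ?thesis by (simp only: complex_norm_square[symmetric] of_real_eq_iff of_real_power[symmetric])
  qed
  have sym: "Re (b * cnj a) = Re (a * cnj b)" for a b by simp
  have norm_eq: "cmod a = cmod b \<longleftrightarrow> (cmod a)\<^sup>2 = (cmod b)\<^sup>2" for a b by simp
  show ?thesis
    unfolding cp2_solution_def
    using C2_on_phase_quot[OF assms(1,2)] C2_on_phase_quot[OF assms(1,3)]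
    by (auto simp only: cp2_eq_phase_quot_iff[OF assms] cp2_eq_phase_quot_iff[OF assms(1,3,2)]
        cp2_eq_cnj_phase_quot_iff[OF assms] cp2_eq_cnj_phase_quot_iff[OF assms(1,3,2)] eq norm_eq
        sym[of "log_deriv F2 _" "log_deriv F1 _"])
qed

section \<open>Unimodular solutions\<close>

lemma cp2_solution_commute: "cp2_solution S w1 w2 \<longleftrightarrow> cp2_solution S w2 w1"
  by (auto simp: cp2_solution_def)

text \<open>The witness is the logarithmic derivative of \<open>w1\<close>. Its
  \<open>wirt_bar\<close> derivative is purely imaginary because \<open>w1\<close> is unimodular,
  and real because of the model equation, hence zero. For \<open>w1 = exp (\<i> * \<theta>)\<close>
  it is \<open>\<i>\<close> times the mixed derivative of the phase \<open>\<theta>\<close>.\<close>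

lemma unimodular_solution_wirt:
  assumes "open S" and sol: "cp2_solution S w1 w2"
    and unimod: "\<And>z. z \<in> S \<Longrightarrow> w1 z * cnj (w1 z) = 1 \<and> w2 z * cnj (w2 z) = 1"
  shows "\<exists>g. g holomorphic_on S \<and>
    (\<forall>z\<in>S. has_wirt w1 (g z * w1 z) (- cnj (g z) * w1 z) z)"
proof -
  have C2: "C2_on S w1" "C2_on S w2" using sol by (auto simp: cp2_solution_def)
  have diff: "has_wirt f (wirt f z) (wirt_bar f z) z" if "f differentiable_on S" "z \<in> S" for f z
    using that assms(1) by (metis differentiable_imp_has_wirt differentiable_on_eq_differentiable_at)
  have first: "wirt w z * cnj (w z) = - cnj (wirt_bar w z * cnj (w z))"
    "wirt_bar w z * cnj (w z) = - cnj (wirt w z * cnj (w z))"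
    if "w differentiable_on S" "\<And>z. z \<in> S \<Longrightarrow> w z * cnj (w z) = 1" "z \<in> S" for w z
  proof -
    have w: "has_wirt w (wirt w z) (wirt_bar w z) z" using diff that by blast
    have "has_wirt (\<lambda>x. 1) 0 0 z" by (simp add: has_wirt_def)
    then have "has_wirt (\<lambda>x. w x * cnj (w x)) 0 0 z"
      by (rule has_wirt_transform[OF _ assms(1) that(3)]) (simp add: that(2))
    from has_wirt_unique[OF has_wirt_mult[OF w has_wirt_cnj[OF w]] this]
    show "wirt w z * cnj (w z) = - cnj (wirt_bar w z * cnj (w z))"
      "wirt_bar w z * cnj (w z) = - cnj (wirt w z * cnj (w z))"
      by (auto simp: eq_neg_iff_add_eq_0 algebra_simps)
  qed
  \<comment> \<open>On the unit circle \<open>cnj (w1 z)\<close> is the reciprocal of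
    \<open>w1 z\<close>, so this is \<open>wirt w1 / w1\<close> without a division.\<close>
  define g where "g = (\<lambda>z. wirt w1 z * cnj (w1 z))"
  have w1: "has_wirt w1 (g z * w1 z) (- cnj (g z) * w1 z) z" if z: "z \<in> S" for z
  proof -
    have d1: "w1 differentiable_on S" using C2 by (simp add: C2_on_def)
    have "cnj (w1 z) * w1 z = 1" using unimod[OF z] by (simp add: mult.commute)
    then have "g z * w1 z = wirt w1 z" "- cnj (g z) * w1 z = wirt_bar w1 z"
      using first(2)[OF d1 _ z] unimod unfolding g_def by (metis mult.assoc mult.right_neutral)+
    then show ?thesis using diff[OF d1 z] by simp
  qed
  have "has_wirt g (wirt g z) 0 z" if z: "z \<in> S" for z
  proof -
    have d: "w1 differentiable_on S" "w2 differentiable_on S"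
      "wirt w1 differentiable_on S" "wirt_bar w1 differentiable_on S"
      using C2 by (auto simp: C2_on_def)
    define p q p2 q2 W1 W2 where "p = wirt w1 z" and "q = wirt_bar w1 z"
      and "p2 = wirt w2 z" and "q2 = wirt_bar w2 z" and "W1 = w1 z" and "W2 = w2 z"
    define h h2 where "h = q * cnj W1" and "h2 = q2 * cnj W2"
    note defs = p_def q_def p2_def q2_def W1_def W2_def
    have W: "W1 * cnj W1 = 1" "W2 * cnj W2 = 1" using unimod[OF z] by (auto simp: defs)
    have f1: "p * cnj W1 = - cnj h" using first(1)[OF d(1) _ z] unimod by (auto simp: defs h_def)
    have f2: "p2 * cnj W2 = - cnj h2" using first(1)[OF d(2) _ z] unimod by (auto simp: defs h2_def)
    have hh: "h * cnj h = q * cnj q" using W by (simp add: h_def algebra_simps)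
    define Q where "Q = wirt (wirt_bar w1) z"
    have Q': "wirt_bar (wirt w1) z = Q"
      unfolding Q_def by (rule wirt_wirt_bar_commute[symmetric, OF assms(1) z d(1,3,4)])
    have A: "A2 w1 w2 z = 3" using unimod[OF z] by (simp add: A2_def)
    have "cp2_eq w1 w2 z" using sol z by (simp add: cp2_solution_def)
    then have "Q - 2 * cnj W1 / 3 * p * q - cnj W2 / 3 * (p * q2 + q * p2) = 0"
      unfolding cp2_eq_def A defs Q_def .
    \<comment> \<open>Multiplication by \<open>cnj W1\<close>, with \<open>W2\<close> already paired
      with its conjugate, expresses everything through \<open>h\<close> and \<open>h2\<close>. The
      right-hand side of \<open>Q1\<close> is then visibly real.\<close>
    then have "0 = cnj W1 * (Q - 2 * cnj W1 / 3 * p * q - cnj W2 / 3 * (p * q2 + q * p2))"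
      by simp
    also have "\<dots> = Q * cnj W1 - (2 / 3 * (p * cnj W1) * (q * cnj W1)
        + 1 / 3 * ((p * cnj W1) * (q2 * cnj W2) + (q * cnj W1) * (p2 * cnj W2)))"
      by (simp add: field_simps)
    finally have Q1: "Q * cnj W1 = - (2 / 3) * (h * cnj h) - 1 / 3 * (cnj h * h2 + h * cnj h2)"
      unfolding f1 f2 unfolding h_def[symmetric] h2_def[symmetric]
      by (simp add: algebra_simps eq_neg_iff_add_eq_0)
    have g: "has_wirt g (wirt (wirt w1) z * cnj W1 + p * cnj q) (Q * cnj W1 + p * cnj p) z"
      unfolding g_def using has_wirt_mult[OF diff[OF d(3) z] has_wirt_cnj[OF diff[OF d(1) z]]]
      by (simp add: Q' defs)
    \<comment> \<open>The function \<open>- cnj (g x)\<close> equals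
      \<open>wirt_bar w1 x * cnj (w1 x)\<close>. Its \<open>wirt\<close> derivative is computed here
      by the product rule and below by conjugating \<open>g\<close>; comparing the two gives the
      imaginary part.\<close>
    have G: "has_wirt (\<lambda>x. - cnj (g x)) (Q * cnj W1 + q * cnj q)
        (wirt_bar (wirt_bar w1) z * cnj W1 + q * cnj p) z"
    proof (rule has_wirt_transform[OF _ assms(1) z])
      show "has_wirt (\<lambda>x. wirt_bar w1 x * cnj (w1 x)) (Q * cnj W1 + q * cnj q)
        (wirt_bar (wirt_bar w1) z * cnj W1 + q * cnj p) z"
        using has_wirt_mult[OF diff[OF d(4) z] has_wirt_cnj[OF diff[OF d(1) z]]]
        by (simp add: Q_def defs)
      show "wirt_bar w1 x * cnj (w1 x) = - cnj (g x)" if "x \<in> S" for x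
        using first(2)[OF d(1) _ that] unimod by (auto simp: g_def)
    qed
    from has_wirt_unique(1)[OF G has_wirt_minus[OF has_wirt_cnj[OF g]]]
    have "Q * cnj W1 + q * cnj q = - cnj (Q * cnj W1 + p * cnj p)" .
    moreover have "p * cnj p = q * cnj q"
    proof -
      have "p * cnj p = (p * cnj W1) * cnj (p * cnj W1)" using W by (simp add: algebra_simps)
      then show ?thesis unfolding f1 using hh by (simp add: mult.commute)
    qed
    moreover have "cnj (Q * cnj W1 + q * cnj q) = Q * cnj W1 + q * cnj q"
      unfolding Q1 by (simp add: algebra_simps)
    ultimately have "2 * (Q * cnj W1 + p * cnj p) = 0" by (simp add: algebra_simps)
    then have "Q * cnj W1 + p * cnj p = 0" unfolding mult_eq_0_iff by simp
    with g show ?thesis using has_wirt_imp(1)[OF g] by simp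
  qed
  then have "g holomorphic_on S"
    using assms(1) unfolding has_field_derivative_iff_has_wirt[symmetric]
    by (meson holomorphic_on_open)
  with w1 show ?thesis by blast
qed

text \<open>On a simply connected set \<open>g\<close> has a primitive \<open>G\<close>, and
  \<open>F = exp G\<close> has logarithmic derivative \<open>g\<close>. Then \<open>w\<close> times
  the inverse of the quotient of \<open>F\<close> is a unimodular constant, which is absorbed into
  \<open>F\<close>.\<close>

lemma phase_quot_representation:
  assumes "open U" "simply_connected U" "g holomorphic_on U"
    and w: "\<And>z. z \<in> U \<Longrightarrow> has_wirt w (g z * w z) (- cnj (g z) * w z) z"
    and unimod: "\<And>z. z \<in> U \<Longrightarrow> cmod (w z) = 1"
  shows "\<exists>F. holo_nonzero U F \<and> (\<forall>z\<in>U. w z = F z / cnj (F z))"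
proof (cases "U = {}")
  case True
  then show ?thesis by (auto simp: holo_nonzero_def intro: holomorphic_on_empty)
next
  case False
  then obtain z0 where z0: "z0 \<in> U" by blast
  obtain G where G: "\<And>z. z \<in> U \<Longrightarrow> (G has_field_derivative g z) (at z)"
    using assms(1-3) simply_connected_eq_global_primitive by blast
  define F where "F = (\<lambda>z. exp (G z))"
  have dF: "(F has_field_derivative g z * F z) (at z)" if "z \<in> U" for z
    unfolding F_def using G[OF that] by (auto intro!: derivative_eq_intros)
  have F: "holo_nonzero U F"
    unfolding holo_nonzero_def using dF assms(1) by (auto simp: F_def holomorphic_on_open)
  note F' = holo_nonzero_inverse[OF F]
  define k where "k = (\<lambda>z. w z * phase_quot (\<lambda>x. inverse (F x)) z)"
  have "(k has_derivative (\<lambda>h. 0)) (at z)" if z: "z \<in> U" for z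
  proof -
    have "log_deriv F z = g z"
      using DERIV_imp_deriv[OF dF[OF z]] by (simp add: log_deriv_def F_def)
    then have "log_deriv (\<lambda>x. inverse (F x)) z = - g z"
      using log_deriv_inverse[OF assms(1) F z] by simp
    from has_wirt_mult[OF w[OF z] has_wirt_phase_quot[OF assms(1) F' z, unfolded this]]
    show ?thesis unfolding k_def[symmetric] has_wirt_def by (simp add: algebra_simps)
  qed
  from has_derivative_zero_unique_connected[OF assms(1) simply_connected_imp_connected[OF assms(2)] this _ z0]
  have k: "k z = k z0" if "z \<in> U" for z using that by blast
  \<comment> \<open>For unimodular \<open>r\<close> the quotient \<open>r / cnj r\<close> is
    \<open>r\<^sup>2\<close>, so a square root of the constant is the right factor for
    \<open>F\<close>.\<close>
  define r where "r = csqrt (k z0)"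
  have "cmod (k z0) = 1"
    using unimod[OF z0] by (simp add: k_def phase_quot_def norm_mult norm_divide norm_inverse F_def)
  then have "cmod r = 1" by (simp add: r_def)
  then have rr: "r * cnj r = 1" using complex_norm_square[of r] by simp
  then have "cnj r = inverse r" by (metis inverse_unique)
  then have "r / cnj r = r\<^sup>2" by (simp add: power2_eq_square divide_inverse)
  then have r: "r / cnj r = k z0" by (simp add: r_def)
  have "r \<noteq> 0" using rr by auto
  have "w z = r * F z / cnj (r * F z)" if z: "z \<in> U" for z
  proof -
    have "w z = k z0 * (F z / cnj (F z))"
      unfolding k[OF z, symmetric] by (simp add: k_def phase_quot_def F_def)
    then show ?thesis by (simp add: r[symmetric])
  qed
  moreover have "holo_nonzero U (\<lambda>z. r * F z)"
    using F \<open>r \<noteq> 0\<close> by (auto simp: holo_nonzero_def intro!: holomorphic_intros)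
  ultimately show ?thesis by blast
qed

section \<open>The exponent\<close>

text \<open>Near a point where \<open>a\<close> does not vanish, \<open>b / a\<close> is holomorphic
  of modulus 1 and hence constant by the maximum modulus principle. Analytic continuation carries
  the identity \<open>b = k * a\<close> to all of \<open>S\<close>, across the zeros of
  \<open>a\<close>.\<close>

lemma norm_eq_imp_phase_multiple:
  assumes "open S" "connected S" "a holomorphic_on S" "b holomorphic_on S"
    and eq: "\<And>z. z \<in> S \<Longrightarrow> cmod (a z) = cmod (b z)"
  shows "\<exists>\<psi>::real. \<forall>z\<in>S. b z = a z * exp (\<i> * of_real \<psi>)"
proof (cases "\<exists>z\<in>S. a z \<noteq> 0")
  case False
  then have "a z = 0" "b z = 0" if "z \<in> S" for z using eq[OF that] that by (metis norm_eq_zero)+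
  then show ?thesis by auto
next
  case True
  then obtain z0 where z0: "z0 \<in> S" "a z0 \<noteq> 0" by blast
  have "open (a -` (- {0}) \<inter> S)"
    using assms(1,3) by (metis continuous_open_vimage continuous_on_open_vimage
        holomorphic_on_imp_continuous_on open_Compl closed_singleton)
  then obtain d where d: "d > 0" "ball z0 d \<subseteq> a -` (- {0}) \<inter> S"
    using z0 by (metis ComplI IntI open_contains_ball singletonD vimageI)
  let ?B = "ball z0 d"
  have nz: "a z \<noteq> 0" "z \<in> S" if "z \<in> ?B" for z using d that by auto
  have one: "cmod (b z / a z) = 1" if "z \<in> ?B" for z
    by (simp add: norm_divide eq[OF nz(2)[OF that], symmetric] nz(1)[OF that])
  have "(\<lambda>z. b z / a z) constant_on ?B"
  proof (rule maximum_modulus_principle[of _ ?B ?B z0])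
    have "a holomorphic_on ?B" "b holomorphic_on ?B"
      using assms(3,4) nz(2) by (blast intro: holomorphic_on_subset)+
    then show "(\<lambda>z. b z / a z) holomorphic_on ?B"
      using nz(1) by (intro holomorphic_on_divide)
    show "cmod (b z / a z) \<le> cmod (b z0 / a z0)" if "z \<in> ?B" for z
      using one[OF that] one[of z0] d(1) by simp
  qed (use d(1) in auto)
  then obtain k where k: "\<And>z. z \<in> ?B \<Longrightarrow> b z / a z = k" by (auto simp: constant_on_def)
  have "cmod k = 1" using k[of z0] one[of z0] d by simp
  then have kexp: "k = exp (\<i> * of_real (Arg k))"
    using rcis_cmod_Arg[of k] by (simp add: rcis_def cis_conv_exp)
  have "b z = k * a z" if "z \<in> S" for z
  proof (rule analytic_continuation_open[of ?B S b "\<lambda>z. k * a z"])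
    show "b z = k * a z" if "z \<in> ?B" for z using k[OF that] nz[OF that] by (simp add: field_simps)
    show "(\<lambda>z. k * a z) holomorphic_on S" using assms(3) by (intro holomorphic_intros)
  qed (use assms(1,2,4) d(1) nz(2) that in auto)
  then show ?thesis using kexp by (metis mult.commute)
qed

lemma cos_half_iff_admissible_angle: "cos \<psi> = 1 / 2 \<longleftrightarrow> admissible_angle \<psi>"
proof
  assume "cos \<psi> = 1 / 2"
  then have "cos \<psi> = cos (pi / 3)" by (simp add: cos_60)
  then obtain n where "n \<in> \<int>" "\<psi> = pi / 3 + 2 * n * pi \<or> \<psi> = - (pi / 3) + 2 * n * pi"
    unfolding cos_eq by blast
  then show "admissible_angle \<psi>"
    unfolding admissible_angle_def by (auto elim!: Ints_cases simp: mult_ac)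
next
  have "cos (x + 2 * pi * of_int m) = cos x" for x and m :: int
    by (simp add: cos_add)
  then show "admissible_angle \<psi> \<Longrightarrow> cos \<psi> = 1 / 2"
    unfolding admissible_angle_def by (metis cos_60 cos_minus)
qed

section \<open>Integrating the equation for \<open>F2\<close> by branches of the logarithm\<close>

lemma log_branch_has_field_derivative:
  assumes "open S" "log_branch S F L" "z \<in> S"
  shows "(L has_field_derivative log_deriv F z) (at z)"
proof -
  have dL: "(L has_field_derivative deriv L z) (at z)"
    using assms by (auto simp: log_branch_def intro: holomorphic_derivI)
  then have "((\<lambda>z. exp (L z)) has_field_derivative exp (L z) * deriv L z) (at z)"
    by (auto intro!: derivative_eq_intros)
  then have "(F has_field_derivative exp (L z) * deriv L z) (at z)"
    unfolding has_field_derivative_iff_has_wirt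
    by (rule has_wirt_transform[OF _ assms(1,3)]) (use assms(2) in \<open>simp add: log_branch_def\<close>)
  from DERIV_imp_deriv[OF this] have "deriv F z = F z * deriv L z" "F z = exp (L z)"
    using assms(2,3) by (simp_all add: log_branch_def)
  then show ?thesis using dL by (simp add: log_deriv_def)
qed

text \<open>Multiplying \<open>F2\<close> by the integrating factor
  \<open>exp (- \<alpha> * L z)\<close> gives a function with zero derivative; its constant value is
  \<open>c\<close>, nonzero because \<open>F2\<close> has no zeros.\<close>

lemma phase_multiple_branch_power:
  assumes "open U" "connected U" "holo_nonzero U F1" "holo_nonzero U F2" "log_branch U F1 L"
    and ode: "\<And>z. z \<in> U \<Longrightarrow> log_deriv F2 z = \<alpha> * log_deriv F1 z"
  shows "\<exists>c. c \<noteq> 0 \<and> (\<forall>z\<in>U. F2 z = c * branch_power L \<alpha> z)"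
proof (cases "U = {}")
  case True
  then show ?thesis by (auto intro: exI[of _ 1])
next
  case False
  then obtain z0 where z0: "z0 \<in> U" by blast
  define k where "k = (\<lambda>z. F2 z * exp (- \<alpha> * L z))"
  have "(k has_field_derivative 0) (at z)" if z: "z \<in> U" for z
  proof -
    have dL: "(L has_field_derivative log_deriv F1 z) (at z)"
      using log_branch_has_field_derivative[OF assms(1,5) z] .
    have d2: "(F2 has_field_derivative deriv F2 z) (at z)"
      using assms z by (auto simp: holo_nonzero_def intro: holomorphic_derivI)
    have "F2 z \<noteq> 0" using assms z by (auto simp: holo_nonzero_def)
    then have "deriv F2 z = F2 z * \<alpha> * log_deriv F1 z"
      using ode[OF z] by (simp add: log_deriv_def[of F2] field_simps)
    then show ?thesis
      unfolding k_def using d2 dL by (auto intro!: derivative_eq_intros simp: algebra_simps)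
  qed
  then have "(k has_derivative (\<lambda>h. 0)) (at z)" if "z \<in> U" for z
    using that by (simp add: has_field_derivative_def lambda_zero)
  from has_derivative_zero_unique_connected[OF assms(1,2) this _ z0]
  have k: "k z = k z0" if "z \<in> U" for z using that by blast
  have "F2 z = k z0 * branch_power L \<alpha> z" if "z \<in> U" for z
    unfolding k[OF that, symmetric] by (simp add: k_def branch_power_def exp_minus)
  moreover have "k z0 \<noteq> 0" using assms(4) z0 by (simp add: k_def holo_nonzero_def)
  ultimately show ?thesis by blast
qed

text \<open>No topological hypothesis on \<open>S\<close> is needed: since \<open>\<alpha> = exp (\<i> * \<psi>)\<close> is not real, the real parts
  \<open>ln \<bar>F1\<bar>\<close> of \<open>L\<close> and \<open>ln \<bar>F2\<bar>\<close> of \<open>\<alpha> * L\<close>, which are single-valued, determine \<open>L\<close> up to a constant.\<close>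

lemma global_log_branch:
  assumes "open S" "connected S" "holo_nonzero S F1" "holo_nonzero S F2" "sin \<psi> \<noteq> 0"
    and ode: "\<And>z. z \<in> S \<Longrightarrow> log_deriv F2 z = exp (\<i> * of_real \<psi>) * log_deriv F1 z"
  shows "\<exists>L. log_branch S F1 L"
proof (cases "S = {}")
  case True
  then show ?thesis by (auto simp: log_branch_def intro: holomorphic_on_empty)
next
  case False
  then obtain z0 where z0: "z0 \<in> S" by blast
  define \<alpha> where "\<alpha> = exp (\<i> * of_real \<psi>)"
  \<comment> \<open>On a ball with a local branch \<open>L\<close>, \<open>ln (cmod (F1 z))\<close>
    is \<open>Re L\<close>, and \<open>ln (cmod (F2 z))\<close> is a constant plus
    \<open>cos \<psi> * Re L - sin \<psi> * Im L\<close>. Solving for \<open>Im L\<close> gives this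
    formula, which agrees with \<open>L\<close> up to an imaginary constant.\<close>
  define M where "M = (\<lambda>z. Complex (ln (cmod (F1 z))) ((cos \<psi> * ln (cmod (F1 z)) - ln (cmod (F2 z))) / sin \<psi>))"
  have loc: "\<exists>d>0. ball z d \<subseteq> S \<and> (\<exists>L k. L holomorphic_on ball z d \<and>
      (\<forall>x\<in>ball z d. F1 x = exp (L x) \<and> M x = L x + k))" if z: "z \<in> S" for z
  proof -
    obtain d where d: "d > 0" "ball z d \<subseteq> S" using assms(1) z open_contains_ball by blast
    have hol: "F1 holomorphic_on ball z d" "F2 holomorphic_on ball z d"
      using assms(3,4) d(2) by (auto simp: holo_nonzero_def intro: holomorphic_on_subset)
    have nz: "F1 x \<noteq> 0" "F2 x \<noteq> 0" if "x \<in> ball z d" for x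
      using assms(3,4) d(2) that by (auto simp: holo_nonzero_def)
    have "simply_connected (ball z d)" by (simp add: convex_imp_simply_connected)
    then obtain L where L: "L holomorphic_on ball z d" "\<And>x. x \<in> ball z d \<Longrightarrow> F1 x = exp (L x)"
      using simply_connected_eq_holomorphic_log[of "ball z d"] hol(1) nz(1) by (metis open_ball)
    have "log_branch (ball z d) F1 L" using L by (simp add: log_branch_def)
    moreover have "holo_nonzero (ball z d) F1" "holo_nonzero (ball z d) F2"
      using hol nz by (auto simp: holo_nonzero_def)
    moreover have "log_deriv F2 x = \<alpha> * log_deriv F1 x" if "x \<in> ball z d" for x
      using ode d(2) that by (auto simp: \<alpha>_def)
    ultimately obtain c where c: "c \<noteq> 0" "\<And>x. x \<in> ball z d \<Longrightarrow> F2 x = c * branch_power L \<alpha> x"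
      using phase_multiple_branch_power[of "ball z d" F1 F2 L \<alpha>] by auto
    have "M x = L x + Complex 0 (- ln (cmod c) / sin \<psi>)" if x: "x \<in> ball z d" for x
    proof -
      have 1: "ln (cmod (F1 x)) = Re (L x)" by (simp add: L(2)[OF x])
      have "Re (\<alpha> * L x) = cos \<psi> * Re (L x) - sin \<psi> * Im (L x)"
        by (simp add: \<alpha>_def cis_conv_exp[symmetric])
      then have "ln (cmod (F2 x)) = ln (cmod c) + (cos \<psi> * Re (L x) - sin \<psi> * Im (L x))"
        using c(1) by (simp add: c(2)[OF x] branch_power_def norm_mult ln_mult)
      then show ?thesis
        using assms(5) by (simp add: complex_eq_iff M_def 1 field_simps)
    qed
    then show ?thesis using d L by blast
  qed
  \<comment> \<open>\<open>k\<close> measures the failure of \<open>M\<close> to be a logarithm of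
    \<open>F1\<close>. It is locally constant, hence constant on the connected set, and adding
    \<open>Ln (k z0)\<close> to \<open>M\<close> corrects the failure everywhere.\<close>
  define k where "k = (\<lambda>z. F1 z * exp (- M z))"
  have der: "(k has_derivative (\<lambda>h. 0)) (at z)" "M field_differentiable (at z)" if z: "z \<in> S" for z
  proof -
    obtain d L c where d: "d > 0" "ball z d \<subseteq> S" and L: "L holomorphic_on ball z d"
      "\<And>x. x \<in> ball z d \<Longrightarrow> F1 x = exp (L x)" "\<And>x. x \<in> ball z d \<Longrightarrow> M x = L x + c"
      using loc[OF z] by metis
    have zb: "z \<in> ball z d" using d by simp
    have const: "exp (- c) = k x" if "x \<in> ball z d" for x
      by (simp add: k_def L(2,3)[OF that] mult_exp_exp)
    show "(k has_derivative (\<lambda>h. 0)) (at z)"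
      by (rule has_derivative_transform_within_open[OF has_derivative_const[of "exp (- c)"] open_ball zb const])
    have "(\<lambda>x. L x + c) holomorphic_on ball z d" using L(1) by (intro holomorphic_intros)
    then have "M holomorphic_on ball z d" using L(3) holomorphic_cong by (metis (no_types, lifting))
    then show "M field_differentiable (at z)"
      using zb holomorphic_on_imp_differentiable_at by blast
  qed
  from has_derivative_zero_unique_connected[OF assms(1,2) der(1) _ z0]
  have k: "k z = k z0" if "z \<in> S" for z using that by blast
  have "k z0 \<noteq> 0" using assms(3) z0 by (simp add: k_def holo_nonzero_def)
  have "exp (M z + Ln (k z0)) = F1 z" if "z \<in> S" for z
  proof -
    have "exp (M z + Ln (k z0)) = exp (M z) * k z" using \<open>k z0 \<noteq> 0\<close> k[OF that] by (simp add: exp_add)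
    then show ?thesis by (simp add: k_def exp_minus)
  qed
  moreover have "(\<lambda>z. M z + Ln (k z0)) holomorphic_on S"
    using der(2) by (intro holomorphic_intros)
      (simp add: holomorphic_on_def field_differentiable_at_within)
  ultimately show ?thesis unfolding log_branch_def by blast
qed

section \<open>The classification\<close>

lemma modulus_condition_iff_log_deriv:
  assumes "F1 z \<noteq> 0" "F2 z \<noteq> 0"
  shows "(cmod (F2 z))\<^sup>2 * (cmod (deriv F1 z))\<^sup>2 = (cmod (F1 z))\<^sup>2 * (cmod (deriv F2 z))\<^sup>2
    \<longleftrightarrow> cmod (log_deriv F1 z) = cmod (log_deriv F2 z)"
proof -
  have "(cmod (F2 z))\<^sup>2 * (cmod (deriv F1 z))\<^sup>2 = (cmod (F1 z))\<^sup>2 * (cmod (deriv F2 z))\<^sup>2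
    \<longleftrightarrow> cmod (F2 z) * cmod (deriv F1 z) = cmod (F1 z) * cmod (deriv F2 z)"
    by (simp flip: power_mult_distrib)
  then show ?thesis using assms by (simp add: log_deriv_def norm_divide field_simps)
qed

lemma ode_iff_log_deriv:
  assumes "F1 z \<noteq> 0" "F2 z \<noteq> 0"
  shows "deriv F2 z = F2 z * deriv F1 z / F1 z * e \<longleftrightarrow> log_deriv F2 z = e * log_deriv F1 z"
  using assms by (auto simp: log_deriv_def field_simps)

lemma log_deriv_zero_imp_constant:
  assumes "open S" "connected S" "holo_nonzero S F" "\<And>z. z \<in> S \<Longrightarrow> log_deriv F z = 0"
  shows "F constant_on S"
proof -
  have "(F has_derivative (\<lambda>h. 0)) (at z)" if "z \<in> S" for z
  proof -
    have "(F has_field_derivative deriv F z) (at z)" "F z \<noteq> 0"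
      using assms(1,3) that by (auto simp: holo_nonzero_def intro: holomorphic_derivI)
    then show ?thesis
      using assms(4)[OF that] by (simp add: log_deriv_def has_field_derivative_def lambda_zero)
  qed
  from has_derivative_zero_unique_connected[OF assms(1,2) this]
  show ?thesis unfolding constant_on_def by metis
qed

text \<open>Here \<open>a * cnj x\<close> is \<open>(cmod a)\<^sup>2\<close> times
  \<open>cis (- \<psi>)\<close>, so the second condition reads
  \<open>(cmod a)\<^sup>2 * (2 * cos \<psi> - 1) = 0\<close>.\<close>

lemma norm_condition_phase:
  assumes "x = a * exp (\<i> * of_real \<psi>)"
  shows "cmod a = cmod x"
    and "(cmod a)\<^sup>2 = 2 * Re (a * cnj x) \<longleftrightarrow> a = 0 \<or> cos \<psi> = 1 / 2"
proof -
  show "cmod a = cmod x" using assms by (simp add: norm_mult)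
  have "a * cnj x = of_real ((cmod a)\<^sup>2) * cis (- \<psi>)"
    using assms complex_norm_square[of a] by (simp add: cis_conv_exp exp_cnj)
  then have "2 * Re (a * cnj x) = (cmod a)\<^sup>2 * (2 * cos \<psi>)"
    by simp
  then show "(cmod a)\<^sup>2 = 2 * Re (a * cnj x) \<longleftrightarrow> a = 0 \<or> cos \<psi> = 1 / 2"
    by auto
qed

text \<open>Conjugation turns the exponent \<open>exp (\<i> * \<psi>)\<close> into
  \<open>exp (- \<i> * \<psi>)\<close> and the branch \<open>L\<close> into its conjugate.\<close>

lemma phase_quot_branch_power:
  assumes "\<And>z. z \<in> S \<Longrightarrow> F z = c * branch_power L (exp (\<i> * of_real \<psi>)) z" "z \<in> S"
  shows "phase_quot F z = c / cnj c * (branch_power L (exp (\<i> * of_real \<psi>)) z /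
      branch_power (cnj \<circ> L) (exp (- \<i> * of_real \<psi>)) z)"
  unfolding phase_quot_def assms(1)[OF assms(2)]
  by (simp add: branch_power_def exp_cnj)

text \<open>Only points where the logarithmic derivative of \<open>F1\<close> is nonzero constrain
  \<open>\<psi>\<close>; nonconstancy on a connected set supplies one.\<close>

lemma solution_ode_imp_admissible_angle:
  assumes "open S" "connected S" "holo_nonzero S F1" "holo_nonzero S F2"
    and sol: "cp2_solution S (phase_quot F1) (phase_quot F2)"
    and "\<And>z. z \<in> S \<Longrightarrow> log_deriv F2 z = exp (\<i> * of_real \<psi>) * log_deriv F1 z"
    and "\<not> F1 constant_on S"
  shows "admissible_angle \<psi>"
proof -
  obtain z where z: "z \<in> S" "log_deriv F1 z \<noteq> 0"
    using log_deriv_zero_imp_constant[OF assms(1-3)] assms(7) by blast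
  moreover have "log_deriv F2 z = log_deriv F1 z * exp (\<i> * of_real \<psi>)"
    using assms(6)[OF z(1)] by (simp add: mult.commute)
  ultimately have "cos \<psi> = 1 / 2"
    using sol norm_condition_phase(2) unfolding cp2_solution_phase_quot_iff[OF assms(1,3,4)] by blast
  then show ?thesis by (rule cos_half_iff_admissible_angle[THEN iffD1])
qed

text \<open>This makes \<open>exp (\<i> * \<psi>)\<close> non-real, so that
  \<open>global_log_branch\<close> applies to solutions.\<close>

lemma admissible_angle_sin_nonzero:
  assumes "admissible_angle \<psi>"
  shows "sin \<psi> \<noteq> 0"
proof
  assume "sin \<psi> = 0"
  then have "(cos \<psi>)\<^sup>2 = 1" using sin_cos_squared_add[of \<psi>] by simp
  moreover have "cos \<psi> = 1 / 2" using assms by (rule cos_half_iff_admissible_angle[THEN iffD2])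
  ultimately show False by (simp add: power2_eq_square)
qed

lemma solution_imp_ode:
  assumes "open S" "connected S" "holo_nonzero S F1" "holo_nonzero S F2"
    and sol: "cp2_solution S (phase_quot F1) (phase_quot F2)"
  shows "\<exists>\<psi>. admissible_angle \<psi> \<and> (\<forall>z\<in>S. log_deriv F2 z = exp (\<i> * of_real \<psi>) * log_deriv F1 z)"
proof -
  have eq: "cmod (log_deriv F1 z) = cmod (log_deriv F2 z)" if "z \<in> S" for z
    using sol that unfolding cp2_solution_phase_quot_iff[OF assms(1,3,4)] by blast
  obtain \<psi> where \<psi>: "\<And>z. z \<in> S \<Longrightarrow> log_deriv F2 z = exp (\<i> * of_real \<psi>) * log_deriv F1 z"
    using norm_eq_imp_phase_multiple[OF assms(1,2) log_deriv_holomorphic[OF assms(1,3)]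
        log_deriv_holomorphic[OF assms(1,4)] eq] by (metis mult.commute)
  show ?thesis
  proof (cases "\<forall>z\<in>S. log_deriv F1 z = 0")
    \<comment> \<open>Both logarithmic derivatives vanish identically, so every angle satisfies the
      equation, and an admissible one may be chosen.\<close>
    case True
    moreover have "admissible_angle (pi / 3)" by (rule cos_half_iff_admissible_angle[THEN iffD1]) (simp add: cos_60)
    ultimately show ?thesis using \<psi> by (metis mult_zero_right)
  next
    case False
    then obtain z where z: "z \<in> S" "log_deriv F1 z \<noteq> 0" by blast
    have "\<not> F1 constant_on S"
    proof
      assume "F1 constant_on S"
      then obtain c where c: "\<And>x. x \<in> S \<Longrightarrow> c = F1 x" unfolding constant_on_def by metis
      have "(F1 has_field_derivative 0) (at z)"
        unfolding has_field_derivative_iff_has_wirt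
        by (rule has_wirt_transform[OF _ assms(1) z(1) c]) (simp add: has_wirt_def)
      then have "deriv F1 z = 0" by (rule DERIV_imp_deriv)
      then show False using z by (simp add: log_deriv_def)
    qed
    then show ?thesis using solution_ode_imp_admissible_angle[OF assms \<psi>] \<psi> by blast
  qed
qed

text \<open>The logarithmic derivative of the power is \<open>exp (\<i> * \<psi>)\<close> times that
  of \<open>F1\<close>, and \<open>cos \<psi> = 1 / 2\<close> then gives both conditions for a
  solution.\<close>

lemma branch_power_solution:
  assumes "open S" "holo_nonzero S F1" "log_branch S F1 L" "c \<noteq> 0" "admissible_angle \<psi>"
  defines "F2 \<equiv> \<lambda>z. c * branch_power L (exp (\<i> * of_real \<psi>)) z"
  shows "holo_nonzero S F2" "cp2_solution S (phase_quot F1) (phase_quot F2)"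
proof -
  define \<alpha> where "\<alpha> = exp (\<i> * of_real \<psi>)"
  have hol: "L holomorphic_on S" using assms(3) by (simp add: log_branch_def)
  then show F2: "holo_nonzero S F2"
    using assms(4) by (auto simp: holo_nonzero_def F2_def branch_power_def intro!: holomorphic_intros)
  have "log_deriv F2 z = log_deriv F1 z * \<alpha>" if z: "z \<in> S" for z
  proof -
    have dL: "(L has_field_derivative log_deriv F1 z) (at z)"
      using log_branch_has_field_derivative[OF assms(1,3) z] .
    have "(F2 has_field_derivative F2 z * (\<alpha> * log_deriv F1 z)) (at z)"
      unfolding F2_def branch_power_def \<alpha>_def using dL by (auto intro!: derivative_eq_intros)
    from DERIV_imp_deriv[OF this] show ?thesis
      using F2 z by (simp add: log_deriv_def[of F2] holo_nonzero_def)
  qed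
  moreover have "cos \<psi> = 1 / 2" using assms(5) by (rule cos_half_iff_admissible_angle[THEN iffD2])
  ultimately show "cp2_solution S (phase_quot F1) (phase_quot F2)"
    unfolding cp2_solution_phase_quot_iff[OF assms(1,2) F2] \<alpha>_def using norm_condition_phase by blast
qed

text \<open>The quotient form is stated on simply connected subsets, where a primitive of
  \<open>wirt w / w\<close> exists. For constant \<open>F1\<close> the angle in the differential
  equation is arbitrary; so the claim about a given \<open>\<psi>\<close> concerns nonconstant
  \<open>F1\<close>, while the explicit form asserts that an admissible angle exists in every
  case.\<close>

theorem mainTheorem6:
  fixes \<Omega> :: "complex set"
  assumes "open \<Omega>" and "connected \<Omega>"
  shows
    "(\<forall>w1 w2. cp2_solution \<Omega> w1 w2 \<longrightarrow>
        (scaling_invariant \<Omega> w1 w2 \<longleftrightarrow>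
         (\<exists>D1 D2 :: real. \<forall>\<xi>\<in>\<Omega>. w1 \<xi> * cnj (w1 \<xi>) = of_real D1 \<and> w2 \<xi> * cnj (w2 \<xi>) = of_real D2)))
     \<and>
     (\<forall>w1 w2 U. cp2_solution \<Omega> w1 w2 \<longrightarrow>
        (\<forall>\<xi>\<in>\<Omega>. w1 \<xi> * cnj (w1 \<xi>) = 1 \<and> w2 \<xi> * cnj (w2 \<xi>) = 1) \<longrightarrow>
        open U \<longrightarrow> simply_connected U \<longrightarrow> U \<subseteq> \<Omega> \<longrightarrow>
        (\<exists>F1 F2. holo_nonzero U F1 \<and> holo_nonzero U F2 \<and>
           (\<forall>\<xi>\<in>U. w1 \<xi> = F1 \<xi> / cnj (F1 \<xi>) \<and> w2 \<xi> = F2 \<xi> / cnj (F2 \<xi>))))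
     \<and>
     (\<forall>F1 F2. holo_nonzero \<Omega> F1 \<longrightarrow> holo_nonzero \<Omega> F2 \<longrightarrow>
        (cp2_solution \<Omega> (phase_quot F1) (phase_quot F2) \<longrightarrow>
           (\<forall>\<xi>\<in>\<Omega>. (cmod (F2 \<xi>))\<^sup>2 * (cmod (deriv F1 \<xi>))\<^sup>2 = (cmod (F1 \<xi>))\<^sup>2 * (cmod (deriv F2 \<xi>))\<^sup>2))
        \<and>
        ((\<forall>\<xi>\<in>\<Omega>. (cmod (F2 \<xi>))\<^sup>2 * (cmod (deriv F1 \<xi>))\<^sup>2 = (cmod (F1 \<xi>))\<^sup>2 * (cmod (deriv F2 \<xi>))\<^sup>2) \<longrightarrow>
           (\<exists>\<psi>::real. \<forall>\<xi>\<in>\<Omega>. deriv F2 \<xi> = F2 \<xi> * deriv F1 \<xi> / F1 \<xi> * exp (\<i> * of_real \<psi>)))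
        \<and>
        (\<forall>\<psi>::real. (\<forall>\<xi>\<in>\<Omega>. deriv F2 \<xi> = F2 \<xi> * deriv F1 \<xi> / F1 \<xi> * exp (\<i> * of_real \<psi>)) \<longrightarrow>
           (\<forall>U L. open U \<longrightarrow> connected U \<longrightarrow> U \<subseteq> \<Omega> \<longrightarrow> log_branch U F1 L \<longrightarrow>
              (\<exists>c. c \<noteq> 0 \<and> (\<forall>\<xi>\<in>U. F2 \<xi> = c * branch_power L (exp (\<i> * of_real \<psi>)) \<xi>)))
           \<and>
           (cp2_solution \<Omega> (phase_quot F1) (phase_quot F2) \<longrightarrow> \<not> F1 constant_on \<Omega> \<longrightarrow>
              admissible_angle \<psi>))
        \<and>
        (cp2_solution \<Omega> (phase_quot F1) (phase_quot F2) \<longrightarrow>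
           (\<exists>\<psi> c L. admissible_angle \<psi> \<and> c \<noteq> 0 \<and> log_branch \<Omega> F1 L \<and>
              (\<forall>\<xi>\<in>\<Omega>. F2 \<xi> = c * branch_power L (exp (\<i> * of_real \<psi>)) \<xi> \<and>
                 phase_quot F2 \<xi> = c / cnj c *
                   (branch_power L (exp (\<i> * of_real \<psi>)) \<xi> /
                    branch_power (cnj \<circ> L) (exp (- \<i> * of_real \<psi>)) \<xi>)))))
     \<and>
     (\<forall>F1 L c \<psi>. holo_nonzero \<Omega> F1 \<longrightarrow> log_branch \<Omega> F1 L \<longrightarrow> c \<noteq> 0 \<longrightarrow> admissible_angle \<psi> \<longrightarrow>
        (let w1 = (\<lambda>\<xi>. F1 \<xi> / cnj (F1 \<xi>));
             w2 = (\<lambda>\<xi>. c / cnj c *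
                    (branch_power L (exp (\<i> * of_real \<psi>)) \<xi> /
                     branch_power (cnj \<circ> L) (exp (- \<i> * of_real \<psi>)) \<xi>))
         in cp2_solution \<Omega> w1 w2 \<and> scaling_invariant \<Omega> w1 w2))"
proof (intro conjI allI impI, goal_cases)
  case (1 w1 w2)
  show ?case by (rule scaling_invariant_iff)
next
  case (2 w1 w2 U)
  have rep: "\<exists>F. holo_nonzero U F \<and> (\<forall>\<xi>\<in>U. v \<xi> = F \<xi> / cnj (F \<xi>))"
    if sol: "cp2_solution \<Omega> v v'"
      and unimod: "\<And>z. z \<in> \<Omega> \<Longrightarrow> v z * cnj (v z) = 1 \<and> v' z * cnj (v' z) = 1" for v v'
  proof -
    obtain g where g: "g holomorphic_on \<Omega>"
      "\<And>z. z \<in> \<Omega> \<Longrightarrow> has_wirt v (g z * v z) (- cnj (g z) * v z) z"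
      using unimodular_solution_wirt[OF assms(1) sol unimod] by blast
    show ?thesis
    proof (rule phase_quot_representation[OF 2(3,4)])
      show "g holomorphic_on U" using g(1) 2(5) by (rule holomorphic_on_subset)
      show "has_wirt v (g z * v z) (- cnj (g z) * v z) z" if "z \<in> U" for z
        using g(2) that 2(5) by blast
      show "cmod (v z) = 1" if "z \<in> U" for z
      proof -
        have "v z * cnj (v z) = 1" using unimod that 2(5) by blast
        then have "of_real ((cmod (v z))\<^sup>2) = (1 :: complex)" by (simp only: complex_norm_square)
        then have "(cmod (v z))\<^sup>2 = 1" using of_real_eq_1_iff by blast
        then show ?thesis by (simp add: power2_eq_1_iff) (smt (verit) norm_ge_zero)
      qed
    qed
  qed
  \<comment> \<open>The system is symmetric in the two indices, so the second component follows from
    \<open>rep\<close> with the roles of \<open>w1\<close> and \<open>w2\<close> exchanged.\<close>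
  show ?case
    using rep[OF 2(1)] rep[of w2 w1] 2(1,2) cp2_solution_commute by metis
next
  case (3 F1 F2)
  then show ?case
    using modulus_condition_iff_log_deriv[of F1 _ F2] cp2_solution_phase_quot_iff[OF assms(1)]
    by (simp add: holo_nonzero_def)
next
  case (4 F1 F2)
  have nz: "F1 z \<noteq> 0" "F2 z \<noteq> 0" if "z \<in> \<Omega>" for z using 4(1,2) that by (auto simp: holo_nonzero_def)
  have "cmod (log_deriv F1 z) = cmod (log_deriv F2 z)" if "z \<in> \<Omega>" for z
    using 4(3) that modulus_condition_iff_log_deriv[of F1 z F2, OF nz[OF that]] by blast
  from norm_eq_imp_phase_multiple[OF assms log_deriv_holomorphic[OF assms(1) 4(1)]
      log_deriv_holomorphic[OF assms(1) 4(2)] this]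
  show ?case using ode_iff_log_deriv[of F1 _ F2, OF nz] by (simp add: mult.commute)
next
  case (5 F1 F2 \<psi> U L)
  have "log_deriv F2 z = exp (\<i> * of_real \<psi>) * log_deriv F1 z" if "z \<in> U" for z
    using 5 that ode_iff_log_deriv[of F1 z F2] unfolding holo_nonzero_def by blast
  moreover have "holo_nonzero U F1" "holo_nonzero U F2"
    using 5(1,2,6) by (auto simp: holo_nonzero_def intro: holomorphic_on_subset)
  ultimately show ?case using 5(4,5,7) phase_multiple_branch_power by blast
next
  case (6 F1 F2 \<psi>)
  have "log_deriv F2 z = exp (\<i> * of_real \<psi>) * log_deriv F1 z" if "z \<in> \<Omega>" for z
    using 6 that ode_iff_log_deriv[of F1 z F2] unfolding holo_nonzero_def by blast
  then show ?case using solution_ode_imp_admissible_angle[OF assms 6(1,2,4) _ 6(5)] by blast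
next
  case (7 F1 F2)
  obtain \<psi> where \<psi>: "admissible_angle \<psi>"
    and ode: "\<And>z. z \<in> \<Omega> \<Longrightarrow> log_deriv F2 z = exp (\<i> * of_real \<psi>) * log_deriv F1 z"
    using solution_imp_ode[OF assms 7] by blast
  obtain L where L: "log_branch \<Omega> F1 L"
    using global_log_branch[OF assms 7(1,2) admissible_angle_sin_nonzero[OF \<psi>] ode] by blast
  obtain c where c: "c \<noteq> 0"
    "\<And>z. z \<in> \<Omega> \<Longrightarrow> F2 z = c * branch_power L (exp (\<i> * of_real \<psi>)) z"
    using phase_multiple_branch_power[OF assms 7(1,2) L ode] by blast
  show ?case using \<psi> L c(1) c(2) phase_quot_branch_power[OF c(2)] by blast
next
  case (8 F1 L c \<psi>)
  define F2 where "F2 = (\<lambda>z. c * branch_power L (exp (\<i> * of_real \<psi>)) z)"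
  have F2: "holo_nonzero \<Omega> F2" and sol: "cp2_solution \<Omega> (phase_quot F1) (phase_quot F2)"
    using branch_power_solution[OF assms(1) 8] by (simp_all add: F2_def)
  have "phase_quot F1 = (\<lambda>\<xi>. F1 \<xi> / cnj (F1 \<xi>))"
    by (simp add: phase_quot_def fun_eq_iff)
  moreover have "phase_quot F2 = (\<lambda>\<xi>. c / cnj c *
                    (branch_power L (exp (\<i> * of_real \<psi>)) \<xi> /
                     branch_power (cnj \<circ> L) (exp (- \<i> * of_real \<psi>)) \<xi>))"
    using phase_quot_branch_power[of UNIV F2 c L \<psi>] by (simp add: F2_def fun_eq_iff)
  \<comment> \<open>Both components are unimodular, so the constants \<open>D1\<close> and
    \<open>D2\<close> are 1.\<close>
  moreover have "scaling_invariant \<Omega> (phase_quot F1) (phase_quot F2)"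
    unfolding scaling_invariant_iff
    using 8(1) F2 by (intro exI[of _ 1]) (auto simp: holo_nonzero_def cnj_phase_quot phase_quot_nonzero)
  ultimately show ?case using sol by (simp only: Let_def)
qed

end
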